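(* Let $n\ge 1$. Let $P$ and $Q$ be cluster variables of $\mathcal P(n)$ such that $P=\Delta_T+P'$ and $Q=\Delta_T+Q'$ for the same semi-standard Young tableau $T$ in the alphabet $[n]$, where $P',Q'\in\mathbb C[x_{ij}]^N$ are both smaller than $\Delta_T$ with respect to the total lexicographical order. Then $P=Q$.
   Context: Notation. $[n]=\{1,\dots,n\}$. $N\subset GL_n(\mathbb C)$ is the group of unipotent upper-triangular matrices. $\mathbb C[x_{ij}]$ is the polynomial ring in the entries of a generic $n\times n$ matrix $x=(x_{ij})_{i,j\in[n]}$ ($i$ is the row index, $j$ the column index), and $\mathbb C[x_{ij}]^N$ (identified with $\mathbb C[GL_n/N]$) is the subring of polynomials $f$ with $f(xu)=f(x)$ for all $u\in N$. For nonempty $I\subset[n]$, the flag minor $\Delta_I\in\mathbb C[x_{ij}]^N$ is the minor of $x$ on the rows $I$ and the first $|I|$ columns. Seeds and mutations. A seed is a quiver with vertex set $V=V_1\sqcup V_2$ ($V_1$ frozen, $V_2$ mutable), with integer skew-symmetric edge multiplicities $w(u,v)=-w(v,u)$ ($w(u,v)>0$ means $w(u,v)$ edges from $u$ to $v$), together with algebraically independent elements $x_v$, $v\in V$, of the field $\mathbb C(x_{ij})$. For $v\in V$, $In(v)=\{v': w(v',v)>0\}$ and $Out(v)=\{v'': w(v,v'')>0\}$. The mutation $\mu_v$ at $v\in V_2$ gives a new seed with the same frozen/mutable vertices: (i) all edges incident to $v$ are reversed; (ii) for each $v'\in In(v)$, $v''\in Out(v)$ the multiplicity $w(v',v'')$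 is replaced by $w(v',v'')+w(v',v)\,w(v,v'')$ (and skew-symmetrically for $(v'',v')$); (iii) all other multiplicities are unchanged; the variables $x_u$, $u\ne v$, are unchanged and $x_v$ is replaced by $x_v^{new}$ with $$x_v^{new}\,x_v=\prod_{v'\in In(v)}x_{v'}^{w(v',v)}+\prod_{v''\in Out(v)}x_{v''}^{w(v,v'')}.$$ The cluster algebra $\mathcal P(n)$. The initial seed has quiver $Q(n)$ with vertices $(i,j)$, $i,j\ge1$, $i+j\le n+1$, and edges (of multiplicity one, whenever both endpoints are vertices) $(i,j)\to(i+1,j)$, $(i,j)\to(i,j-1)$, $(i,j)\to(i-1,j+1)$. The frozen vertices are $(1,j)$, $1\le j\le n$, and $(i,j)$ with $i+j=n+1$; all other vertices are mutable. The variable at $(i,j)$ is the interval flag minor $\Delta_{\{i,i+1,\dots,i+j-1\}}$. The seeds of $\mathcal P(n)$ are all seeds obtained from the initial one by finite sequences of mutations at mutable vertices; the cluster variables of $\mathcal P(n)$ are all the elements $x_v\in\mathbb C(x_{ij})$ (including those at frozen vertices) occurring in these seeds. Tableaux. A semi-standard Young tableau in the alphabet $[n]$ is a filling of the boxes of a Young diagram (rows numbered from bottom to top, left-justified, of weakly decreasing lengths $\lambda_1\ge\lambda_2\ge\dots$) by elements of $[n]$ that is non-decreasing along rows (left to right) and strictly increasing along columns (bottom to top). If $T_1,\dots,T_{\lambda_1}\subset[n]$ are the sets of entries of the columns of $T$, then $\Delta_T:=\Delta_{T_1}\cdots\Delta_{T_{\lambda_1}}$. Order. Order the variables by $x_{ij}\succ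 x_{kl}$ if $i<k$, or $i=k$ and $j<l$, and let $\succ$ also denote the resulting lexicographic order on the monomials of $\mathbb C[x_{ij}]$. A polynomial $P'$ is smaller than $\Delta_T$ if $P'=0$ or the leading (largest) monomial of $P'$ is strictly smaller than the leading monomial of $\Delta_T$. *)

theory Defs
  imports Complex_Main
    "Jordan_Normal_Form.Determinant"
    "HOL-Library.Product_Lexorder"
    "HOL-Library.Poly_Mapping"
begin

section \<open>Polynomials in the matrix entries\<close>

text \<open>
  The variables are \<open>x\<^sub>i\<^sub>j\<close> for all pairs of natural numbers \<open>(i, j)\<close>, so that one type serves every
  \<open>n\<close>; the ring belonging to \<open>n\<close> is the subset \<open>poly_ring n\<close>, and its field of fractions is a
  subfield of \<open>ratfun\<close>.
\<close>

type_synonym monomial = "(nat \<times> nat) \<Rightarrow>\<^sub>0 nat"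
type_synonym mpoly = "monomial \<Rightarrow>\<^sub>0 complex"
type_synonym ratfun = "mpoly fract"

definition Const :: "complex \<Rightarrow> mpoly" where
  "Const c = Poly_Mapping.single 0 c"

definition Var :: "nat \<times> nat \<Rightarrow> mpoly" where
  "Var v = Poly_Mapping.single (Poly_Mapping.single v 1) 1"

definition poly_ring :: "nat \<Rightarrow> mpoly set" where
  "poly_ring n = {p. \<forall>m \<in> Poly_Mapping.keys p. Poly_Mapping.keys m \<subseteq> {1..n} \<times> {1..n}}"

text \<open>Matrix entries are addressed from \<open>0\<close> in type \<open>mat\<close>, but variables are numbered from \<open>1\<close>.\<close>

definition generic_mat :: "nat \<Rightarrow> mpoly mat" where
  "generic_mat n = mat n n (\<lambda>(i, j). Var (i + 1, j + 1))"

definition subst_mat :: "mpoly mat \<Rightarrow> mpoly \<Rightarrow> mpoly" where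
  "subst_mat A p =
     (\<Sum>m \<in> Poly_Mapping.keys p. Const (Poly_Mapping.lookup p m) *
        (\<Prod>(i, j) \<in> Poly_Mapping.keys m. (A $$ (i - 1, j - 1)) ^ Poly_Mapping.lookup m (i, j)))"

definition unipotent_group :: "nat \<Rightarrow> complex mat set" where
  "unipotent_group n =
     {u \<in> carrier_mat n n. upper_triangular u \<and> (\<forall>i < n. u $$ (i, i) = 1)}"

definition invariant_ring :: "nat \<Rightarrow> mpoly set" where
  "invariant_ring n =
     {f \<in> poly_ring n. \<forall>u \<in> unipotent_group n. subst_mat (generic_mat n * map_mat Const u) f = f}"

definition flag_minor :: "nat set \<Rightarrow> mpoly" where
  "flag_minor I =
     det (mat (card I) (card I) (\<lambda>(a, b). Var (sorted_list_of_set I ! a, b + 1)))"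


section \<open>The lexicographic order\<close>

text \<open>
  The order on type \<open>monomial\<close> is the library's linear order on \<open>\<Rightarrow>\<^sub>0\<close>: \<open>m < m'\<close> iff, at the
  smallest index where they differ, the exponent in \<open>m\<close> is less than that in \<open>m'\<close>. Indices \<open>(i, j)\<close>
  are compared lexicographically, so a smaller index is a larger variable: \<open>x\<^sub>i\<^sub>j\<close> is larger than
  \<open>x\<^sub>k\<^sub>l\<close> iff \<open>i < k\<close>, or \<open>i = k\<close> and \<open>j < l\<close>.
\<close>

definition leading_monomial :: "mpoly \<Rightarrow> monomial" where
  "leading_monomial p = Max (Poly_Mapping.keys p)"

definition smaller_than :: "mpoly \<Rightarrow> mpoly \<Rightarrow> bool" where
  "smaller_than p q \<longleftrightarrow> p = 0 \<or> leading_monomial p < leading_monomial q"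


section \<open>Semi-standard Young tableaux\<close>

text \<open>A tableau is the list of its rows, from bottom to top.\<close>

definition ssyt :: "nat \<Rightarrow> nat list list \<Rightarrow> bool" where
  "ssyt n T \<longleftrightarrow>
     [] \<notin> set T \<and>
     (\<forall>r. Suc r < length T \<longrightarrow> length (T ! Suc r) \<le> length (T ! r)) \<and>
     (\<forall>row \<in> set T. set row \<subseteq> {1..n} \<and> sorted row) \<and>
     (\<forall>r c. Suc r < length T \<longrightarrow> c < length (T ! Suc r) \<longrightarrow> T ! r ! c < T ! Suc r ! c)"

definition column :: "nat list list \<Rightarrow> nat \<Rightarrow> nat set" where
  "column T c = {T ! r ! c | r. r < length T \<and> c < length (T ! r)}"

definition num_columns :: "nat list list \<Rightarrow> nat" where
  "num_columns T = (if T = [] then 0 else length (hd T))"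

definition tableau_poly :: "nat list list \<Rightarrow> mpoly" where
  "tableau_poly T = (\<Prod>c < num_columns T. flag_minor (column T c))"


section \<open>Seeds and mutations\<close>

text \<open>
  Skew-symmetry of \<open>mult\<close> and algebraic independence of the variables are not part of the type.
  They hold for the initial seed below and are preserved by mutation, hence hold for all seeds
  considered here; in particular the division in \<open>mutate\<close> is by a nonzero element.
\<close>

record 'v seed =
  frozen :: "'v set"
  mutable :: "'v set"
  mult :: "'v \<Rightarrow> 'v \<Rightarrow> int"
  cvar :: "'v \<Rightarrow> ratfun"

definition vertices :: "'v seed \<Rightarrow> 'v set" where
  "vertices s = frozen s \<union> mutable s"

definition In :: "'v seed \<Rightarrow> 'v \<Rightarrow> 'v set" where
  "In s v = {v' \<in> vertices s. mult s v' v > 0}"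

definition Out :: "'v seed \<Rightarrow> 'v \<Rightarrow> 'v set" where
  "Out s v = {v'' \<in> vertices s. mult s v v'' > 0}"

definition mutate_mult :: "'v seed \<Rightarrow> 'v \<Rightarrow> 'v \<Rightarrow> 'v \<Rightarrow> int" where
  "mutate_mult s v a b =
     (if a = v \<or> b = v then - mult s a b
      else if a \<in> In s v \<and> b \<in> Out s v then mult s a b + mult s a v * mult s v b
      else if b \<in> In s v \<and> a \<in> Out s v then - (mult s b a + mult s b v * mult s v a)
      else mult s a b)"

definition mutate_var :: "'v seed \<Rightarrow> 'v \<Rightarrow> ratfun" where
  "mutate_var s v =
     ((\<Prod>v' \<in> In s v. cvar s v' ^ nat (mult s v' v)) +
      (\<Prod>v'' \<in> Out s v. cvar s v'' ^ nat (mult s v v''))) / cvar s v"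

definition mutate :: "'v \<Rightarrow> 'v seed \<Rightarrow> 'v seed" where
  "mutate v s = s\<lparr>mult := mutate_mult s v, cvar := (cvar s)(v := mutate_var s v)\<rparr>"


section \<open>The cluster algebra\<close>

definition initial_vertices :: "nat \<Rightarrow> (nat \<times> nat) set" where
  "initial_vertices n = {(i, j). 1 \<le> i \<and> 1 \<le> j \<and> i + j \<le> n + 1}"

definition initial_frozen :: "nat \<Rightarrow> (nat \<times> nat) set" where
  "initial_frozen n = {(i, j) \<in> initial_vertices n. i = 1 \<or> i + j = n + 1}"

definition initial_edge :: "nat \<Rightarrow> nat \<times> nat \<Rightarrow> nat \<times> nat \<Rightarrow> bool" where
  "initial_edge n a b \<longleftrightarrow>
     a \<in> initial_vertices n \<and> b \<in> initial_vertices n \<and>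
     (case (a, b) of ((i, j), (k, l)) \<Rightarrow>
        (k = i + 1 \<and> l = j) \<or> (k = i \<and> j = l + 1) \<or> (i = k + 1 \<and> l = j + 1))"

definition initial_seed :: "nat \<Rightarrow> (nat \<times> nat) seed" where
  "initial_seed n =
     \<lparr>frozen = initial_frozen n,
      mutable = initial_vertices n - initial_frozen n,
      mult = (\<lambda>a b. of_bool (initial_edge n a b) - of_bool (initial_edge n b a)),
      cvar = (\<lambda>(i, j). to_fract (flag_minor {i..<i + j}))\<rparr>"

inductive_set seeds :: "nat \<Rightarrow> (nat \<times> nat) seed set" for n :: nat where
  initial: "initial_seed n \<in> seeds n"
| mutation: "s \<in> seeds n \<Longrightarrow> v \<in> mutable s \<Longrightarrow> mutate v s \<in> seeds n"

definition cluster_variables :: "nat \<Rightarrow> ratfun set" where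
  "cluster_variables n = {cvar s v | s v. s \<in> seeds n \<and> v \<in> vertices s}"

end

(* A cluster has a valuation attached to any total order on its Laurent monomials, and a valuation
   that is injective on the Laurent monomials of one cluster is injective on those of every other:
   the two terms of an exchange relation then have different values, so the new variable has the
   value of a monomial in which the old one has exponent -1. The lexicographic leading exponent is
   such a valuation for the initial cluster. Hence, if P lies in a cluster t, Q in a cluster s and
   they have the same leading exponent, the Laurent expansion of Q in t contains the monomial P
   and the expansion of P in s contains the monomial Q. If the expansion of Q in t also contained
   another monomial m, some valuation would give m, hence Q, a larger value than P; but in s it
   gives P at least the value of Q. So Q is a multiple of P, and the leading coefficients agree.

   The Laurent phenomenon is needed for all pairs of clusters. It follows by induction on the number
   of mutations from the case of three mutations at i, j, i, where the first new variable at i is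
   coprime to the other two new variables. *)

theory Submission
  imports Defs
begin

section \<open>Valuations from weights of exponents\<close>

text \<open>Everything rests on the columns of the exchange matrix (rows at all vertices, columns at
  mutable ones) being linearly independent: the initial quiver has this property and mutation
  preserves it. It makes the two terms of an exchange relation different monomials, and it makes two
  exchange binomials coprime when their vertices are not joined by arrows. Algebraic independence of
  a cluster comes from the valuation: when distinct Laurent monomials have distinct values, no
  nonzero Laurent polynomial in them can vanish. The valuations that compare \<open>P\<close> with
  \<open>Q\<close> are read off from Laurent expansions in one cluster and live on the subfield
  generated by it, which is why valuations are taken relative to a subfield \<open>R\<close>.
  Exchange relations have coefficients 1, so integer coefficients suffice for Laurent polynomials
  and the factor between \<open>P\<close> and \<open>Q\<close> is an integer. Coprimality in a
  Laurent ring has two sources: one element is a unit modulo the other, or both are binomials up to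
  units and a grading separates them.\<close>

lemma sum_single_keys: "(\<Sum>m\<in>Poly_Mapping.keys p. Poly_Mapping.single m (Poly_Mapping.lookup p m)) = p"
  by (rule poly_mapping_eqI)
    (auto simp: lookup_sum lookup_single when_def in_keys_iff sum.If_cases sum.delta)

lemma mult_eq_sum_single:
  fixes p q :: "'m::comm_monoid_add \<Rightarrow>\<^sub>0 'c::comm_semiring_0"
  shows "p * q = (\<Sum>a\<in>Poly_Mapping.keys p. \<Sum>b\<in>Poly_Mapping.keys q.
    Poly_Mapping.single (a + b) (Poly_Mapping.lookup p a * Poly_Mapping.lookup q b))"
proof -
  have "p * q = (\<Sum>a\<in>Poly_Mapping.keys p. Poly_Mapping.single a (Poly_Mapping.lookup p a))
      * (\<Sum>b\<in>Poly_Mapping.keys q. Poly_Mapping.single b (Poly_Mapping.lookup q b))"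
    by (simp only: sum_single_keys)
  then show ?thesis
    by (simp add: sum_product mult_single)
qed

text \<open>The degree for the grading \<open>W\<close>. It is unspecified at 0, so the rules for
  sums and products below assume nonzero arguments.\<close>

definition weight :: "('m \<Rightarrow> 'g::linorder) \<Rightarrow> ('m \<Rightarrow>\<^sub>0 'c::zero) \<Rightarrow> 'g" where
  "weight W p = Max (W ` Poly_Mapping.keys p)"

lemma weight_ge: "m \<in> Poly_Mapping.keys p \<Longrightarrow> W m \<le> weight W p"
  by (simp add: weight_def)

lemma weight_attained:
  assumes "p \<noteq> 0"
  obtains m where "m \<in> Poly_Mapping.keys p" "weight W p = W m"
proof -
  have "Max (W ` Poly_Mapping.keys p) \<in> W ` Poly_Mapping.keys p"
    using assms by (intro Max_in) auto
  then show ?thesis using that by (auto simp: weight_def)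
qed

lemma weight_single: "c \<noteq> 0 \<Longrightarrow> weight W (Poly_Mapping.single m c) = W m"
  by (simp add: weight_def)

lemma weight_add_le:
  assumes "p \<noteq> 0" "q \<noteq> 0" "p + q \<noteq> 0"
  shows "weight W (p + q) \<le> max (weight W p) (weight W q)"
proof -
  obtain m where m: "m \<in> Poly_Mapping.keys (p + q)" "weight W (p + q) = W m"
    using weight_attained[OF assms(3)] .
  have "m \<in> Poly_Mapping.keys p \<or> m \<in> Poly_Mapping.keys q"
    using m(1) keys_add[of p q] by auto
  then have "W m \<le> weight W p \<or> W m \<le> weight W q"
    using weight_ge[of m p W] weight_ge[of m q W] by blast
  then show ?thesis using m(2) by (simp add: le_max_iff_disj)
qed

text \<open>Injectivity of \<open>W\<close> makes the pair of top exponents the only pair with its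
  sum, so the coefficient there is a product of two nonzero elements of a domain. The same
  coefficient excludes zero divisors.\<close>

lemma weight_mult:
  fixes W :: "'m::comm_monoid_add \<Rightarrow> 'g::linordered_ab_group_add" and p q :: "'m \<Rightarrow>\<^sub>0 'c::idom"
  assumes W: "\<And>a b. W (a + b) = W a + W b" "inj W" and nz: "p \<noteq> 0" "q \<noteq> 0"
  shows "p * q \<noteq> 0" "weight W (p * q) = weight W p + weight W q"
proof -
  obtain m where m: "m \<in> Poly_Mapping.keys p" "weight W p = W m"
    using weight_attained[OF nz(1)] .
  obtain n where n: "n \<in> Poly_Mapping.keys q" "weight W q = W n"
    using weight_attained[OF nz(2)] .
  have uniq: "a + b = m + n \<longleftrightarrow> a = m \<and> b = n"
    if "a \<in> Poly_Mapping.keys p" "b \<in> Poly_Mapping.keys q" for a b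
  proof
    assume "a + b = m + n"
    then have eq: "W a + W b = W m + W n" by (metis W(1))
    moreover have "W a \<le> W m" "W b \<le> W n"
      using weight_ge[OF that(1), of W] weight_ge[OF that(2), of W] m n by auto
    ultimately have "W a = W m" "W b = W n"
      by (metis add_less_le_mono add_le_less_mono order_le_less order_less_irrefl)+
    then show "a = m \<and> b = n" using W(2) by (auto dest: injD)
  qed auto
  have "Poly_Mapping.lookup (p * q) (m + n) = (\<Sum>a\<in>Poly_Mapping.keys p. \<Sum>b\<in>Poly_Mapping.keys q.
      if a = m \<and> b = n then Poly_Mapping.lookup p a * Poly_Mapping.lookup q b else 0)"
    by (subst mult_eq_sum_single)
      (auto simp: lookup_sum lookup_single when_def uniq intro!: sum.cong)
  also have "\<dots> = (\<Sum>a\<in>Poly_Mapping.keys p.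
      if a = m then Poly_Mapping.lookup p a * Poly_Mapping.lookup q n else 0)"
    using n(1) by (intro sum.cong) (auto simp: sum.delta)
  also have "\<dots> = Poly_Mapping.lookup p m * Poly_Mapping.lookup q n"
    using m(1) by (simp add: sum.delta)
  finally have key: "m + n \<in> Poly_Mapping.keys (p * q)"
    using m(1) n(1) by (simp add: in_keys_iff)
  then show nz': "p * q \<noteq> 0" by auto
  obtain k where k: "k \<in> Poly_Mapping.keys (p * q)" "weight W (p * q) = W k"
    using weight_attained[OF nz'] .
  obtain a b where "k = a + b" "a \<in> Poly_Mapping.keys p" "b \<in> Poly_Mapping.keys q"
    using k(1) keys_mult by blast
  then have "weight W (p * q) \<le> weight W p + weight W q"
    using k(2) by (simp add: W(1) weight_ge add_mono)
  moreover have "weight W p + weight W q \<le> weight W (p * q)"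
    using weight_ge[OF key, of W] m(2) n(2) by (simp add: W(1))
  ultimately show "weight W (p * q) = weight W p + weight W q" by simp
qed

section \<open>Subrings as sets, and valuations on a subfield\<close>

definition is_subring :: "'a::comm_ring_1 set \<Rightarrow> bool" where
  "is_subring A \<longleftrightarrow> 1 \<in> A \<and> (\<forall>a\<in>A. \<forall>b\<in>A. a - b \<in> A \<and> a * b \<in> A)"

context
  fixes A :: "'a::comm_ring_1 set"
  assumes A: "is_subring A"
begin

lemma subring_one: "1 \<in> A"
  using A by (auto simp: is_subring_def)

lemma subring_diff: "a \<in> A \<Longrightarrow> b \<in> A \<Longrightarrow> a - b \<in> A"
  using A by (auto simp: is_subring_def)

lemma subring_mult: "a \<in> A \<Longrightarrow> b \<in> A \<Longrightarrow> a * b \<in> A"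
  using A by (auto simp: is_subring_def)

lemma subring_zero: "0 \<in> A"
  using subring_diff[OF subring_one subring_one] by simp

lemma subring_uminus: "a \<in> A \<Longrightarrow> - a \<in> A"
  using subring_diff[OF subring_zero] by fastforce

lemma subring_add: "a \<in> A \<Longrightarrow> b \<in> A \<Longrightarrow> a + b \<in> A"
  using subring_diff[OF _ subring_uminus] by fastforce

lemma subring_power: "a \<in> A \<Longrightarrow> a ^ n \<in> A"
  by (induction n) (auto intro: subring_one subring_mult)

lemma subring_sum: "(\<And>i. i \<in> I \<Longrightarrow> f i \<in> A) \<Longrightarrow> sum f I \<in> A"
  by (induction I rule: infinite_finite_induct) (auto intro: subring_zero subring_add)

lemma subring_prod: "(\<And>i. i \<in> I \<Longrightarrow> f i \<in> A) \<Longrightarrow> prod f I \<in> A"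
  by (induction I rule: infinite_finite_induct) (auto intro: subring_one subring_mult)

lemma subring_of_int: "of_int c \<in> A"
proof -
  have "of_nat k \<in> A" for k
    by (induction k) (auto intro: subring_zero subring_one subring_add)
  then show ?thesis by (cases c rule: int_cases2) (auto intro: subring_uminus)
qed

end

lemma is_subring_UNIV: "is_subring UNIV"
  by (simp add: is_subring_def)

text \<open>A valuation in the degree convention, where the value of a sum is at most the maximum.
  Nonzero integers have value 0 because they will occur as coefficients of Laurent
  polynomials.\<close>

locale subfield_valuation =
  fixes R :: "'k::field set" and val :: "'k \<Rightarrow> 'g::linordered_ab_group_add"
  assumes subring: "is_subring R"
    and inverse_in: "a \<in> R \<Longrightarrow> inverse a \<in> R"
    and val_mult: "a \<in> R \<Longrightarrow> b \<in> R \<Longrightarrow> a \<noteq> 0 \<Longrightarrow> b \<noteq> 0 \<Longrightarrow> val (a * b) = val a + val b"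
    and val_add_le: "a \<in> R \<Longrightarrow> b \<in> R \<Longrightarrow> a \<noteq> 0 \<Longrightarrow> b \<noteq> 0 \<Longrightarrow> a + b \<noteq> 0 \<Longrightarrow>
      val (a + b) \<le> max (val a) (val b)"
    and of_int_nz: "c \<noteq> 0 \<Longrightarrow> (of_int c :: 'k) \<noteq> 0"
    and val_of_int: "c \<noteq> 0 \<Longrightarrow> val (of_int c) = 0"
begin

lemmas R_closed = subring_one[OF subring] subring_zero[OF subring] subring_add[OF subring]
  subring_diff[OF subring] subring_uminus[OF subring] subring_mult[OF subring]
  subring_power[OF subring] subring_sum[OF subring] subring_prod[OF subring]
  subring_of_int[OF subring] inverse_in

lemma divide_in: "a \<in> R \<Longrightarrow> b \<in> R \<Longrightarrow> a / b \<in> R"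
  by (simp add: divide_inverse R_closed)

lemma power_int_in: "a \<in> R \<Longrightarrow> a powi n \<in> R"
  by (auto simp: power_int_def R_closed)

lemma val_1: "val 1 = 0"
  using val_of_int[of 1] by simp

lemma val_uminus: "a \<in> R \<Longrightarrow> a \<noteq> 0 \<Longrightarrow> val (- a) = val a"
  using val_mult[of "-1" a] val_of_int[of "-1"] R_closed by simp

lemma val_inverse: "a \<in> R \<Longrightarrow> a \<noteq> 0 \<Longrightarrow> val (inverse a) = - val a"
  using val_mult[of a "inverse a"] val_1 R_closed
  by (metis add_eq_0_iff inverse_nonzero_iff_nonzero right_inverse)

lemma val_divide: "a \<in> R \<Longrightarrow> b \<in> R \<Longrightarrow> a \<noteq> 0 \<Longrightarrow> b \<noteq> 0 \<Longrightarrow> val (a / b) = val a - val b"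
  by (simp add: divide_inverse val_mult val_inverse R_closed)

lemma val_add_less:
  assumes "a \<in> R" "b \<in> R" "b \<noteq> 0" "a \<noteq> 0 \<Longrightarrow> val a < val b"
  shows "a + b \<noteq> 0" "val (a + b) = val b"
proof -
  show nz: "a + b \<noteq> 0"
    using assms val_uminus[of b] by (metis add_eq_0_iff2 add_0 order_less_irrefl)
  show "val (a + b) = val b"
  proof (cases "a = 0")
    case False
    \<comment> \<open>Writing \<open>b\<close> as \<open>(a + b) + (- a)\<close> gives the lower
      bound, as the value of \<open>- a\<close> is too small to reach \<open>val b\<close>.\<close>
    have "val b \<le> max (val (a + b)) (val (- a))"
      using val_add_le[of "a + b" "- a"] assms nz False R_closed by simp
    then show ?thesis
      using val_add_le[of a b] assms nz False val_uminus[of a]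
      by (auto simp: le_max_iff_disj max_def split: if_splits)
  qed simp
qed

lemma val_add_neq:
  assumes "a \<in> R" "b \<in> R" "a \<noteq> 0" "b \<noteq> 0" "val a \<noteq> val b"
  shows "a + b \<noteq> 0" "val (a + b) = max (val a) (val b)"
proof -
  have "a + b \<noteq> 0 \<and> val (a + b) = max (val a) (val b)"
  proof (cases "val a < val b")
    case True
    then show ?thesis using val_add_less[of a b] assms by simp
  next
    case False
    then have "val b < val a" using assms(5) by simp
    then show ?thesis using val_add_less[of b a] assms by (simp add: add.commute)
  qed
  then show "a + b \<noteq> 0" "val (a + b) = max (val a) (val b)" by auto
qed

text \<open>No cancellation can occur: the value of a partial sum is the value of one of its terms,
  hence different from the value of the next term.\<close>

lemma val_sum_distinct:
  assumes "finite S" "S \<noteq> {}" "\<And>i. i \<in> S \<Longrightarrow> f i \<in> R \<and> f i \<noteq> 0" "inj_on (\<lambda>i. val (f i)) S"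
  shows "sum f S \<noteq> 0 \<and> val (sum f S) = Max ((\<lambda>i. val (f i)) ` S)"
  using assms
proof (induction S rule: finite_ne_induct)
  case (insert i S)
  let ?V = "(\<lambda>i. val (f i)) ` S"
  have IH: "sum f S \<noteq> 0" "val (sum f S) = Max ?V"
    using insert by (auto simp: inj_on_def)
  have "Max ?V \<in> ?V" using insert by (intro Max_in) auto
  moreover have "val (f i) \<notin> ?V" using insert by (auto simp: inj_on_def)
  ultimately have neq: "val (f i) \<noteq> val (sum f S)" using IH by metis
  have "sum f S \<in> R" using insert by (intro R_closed) auto
  then show ?case
    using val_add_neq[OF _ _ _ IH(1) neq] insert IH by simp
qed simp

lemma val_power_int_eq_0:
  assumes "a \<in> R" "a \<noteq> 0" "val a = 0"
  shows "val (a powi n) = 0"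
proof -
  have *: "val (b ^ k) = 0" if "b \<in> R" "b \<noteq> 0" "val b = 0" for b k
    using that by (induction k) (auto simp: val_1 val_mult R_closed)
  show ?thesis
    using * assms by (auto simp: power_int_def R_closed val_inverse)
qed

lemma val_power_int_cong:
  assumes "a \<in> R" "a \<noteq> 0" "b \<in> R" "b \<noteq> 0" "val a = val b"
  shows "val (a powi n) = val (b powi n)"
proof -
  have "val ((a / b) powi n) = 0"
    using assms by (intro val_power_int_eq_0) (auto simp: divide_in val_divide)
  then show ?thesis
    using assms by (simp add: power_int_divide_distrib val_divide power_int_in)
qed

end

text \<open>The valuation of a fraction does not depend on its representation, so \<open>SOME\<close> picks the value.\<close>

definition fractions :: "('p \<Rightarrow> 'k::field) \<Rightarrow> 'p::zero set \<Rightarrow> 'k set" where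
  "fractions \<psi> S = {\<psi> p / \<psi> q | p q. p \<in> S \<and> q \<in> S \<and> q \<noteq> 0}"

definition weight_val ::
  "(('m \<Rightarrow>\<^sub>0 'c::zero) \<Rightarrow> 'k::field) \<Rightarrow> ('m \<Rightarrow>\<^sub>0 'c) set \<Rightarrow> ('m \<Rightarrow> 'g::linordered_ab_group_add) \<Rightarrow> 'k \<Rightarrow> 'g" where
  "weight_val \<psi> S W f = (SOME g. \<exists>p\<in>S. \<exists>q\<in>S. p \<noteq> 0 \<and> q \<noteq> 0 \<and> f = \<psi> p / \<psi> q \<and> g = weight W p - weight W q)"

text \<open>Serves two purposes: complex polynomials in the matrix entries with the lexicographic
  order, and Laurent polynomials in a cluster with an order on exponents. In the second case
  \<open>S\<close> restricts to exponents supported on the vertices, where evaluation at the cluster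
  is injective.\<close>

locale weighted_ring =
  fixes \<psi> :: "('m::cancel_comm_monoid_add \<Rightarrow>\<^sub>0 'c::idom) \<Rightarrow> 'k::field"
    and S :: "('m \<Rightarrow>\<^sub>0 'c) set"
    and W :: "'m \<Rightarrow> 'g::linordered_ab_group_add"
  assumes S: "is_subring S"
    and add: "\<psi> (p + q) = \<psi> p + \<psi> q"
    and mult: "\<psi> (p * q) = \<psi> p * \<psi> q"
    and one: "\<psi> 1 = 1"
    and inj0: "p \<in> S \<Longrightarrow> \<psi> p = 0 \<Longrightarrow> p = 0"
    and W_add: "W (a + b) = W a + W b"
    and W_inj: "inj W"
    and char_0: "c \<noteq> 0 \<Longrightarrow> (of_int c :: 'c) \<noteq> 0"
begin

lemma zero: "\<psi> 0 = 0"
  by (metis add add_0 add_cancel_right_left)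

lemma nz: "p \<in> S \<Longrightarrow> \<psi> p = 0 \<longleftrightarrow> p = 0"
  using inj0 zero by auto

lemma uminus: "\<psi> (- p) = - \<psi> p"
  using add[of p "- p"] zero by (simp add: eq_neg_iff_add_eq_0 add.commute)

lemma diff: "\<psi> (p - q) = \<psi> p - \<psi> q"
  using add[of p "- q"] uminus by simp

lemma no_zero_div: "(p :: 'm \<Rightarrow>\<^sub>0 'c) \<noteq> 0 \<Longrightarrow> q \<noteq> 0 \<Longrightarrow> p * q \<noteq> 0"
  by (rule weight_mult(1)[OF W_add W_inj])

lemma weight_times: "(p :: 'm \<Rightarrow>\<^sub>0 'c) \<noteq> 0 \<Longrightarrow> q \<noteq> 0 \<Longrightarrow> weight W (p * q) = weight W p + weight W q"
  by (rule weight_mult(2)[OF W_add W_inj])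

lemma weight_val_frac:
  assumes "p \<in> S" "q \<in> S" "p \<noteq> 0" "q \<noteq> 0"
  shows "weight_val \<psi> S W (\<psi> p / \<psi> q) = weight W p - weight W q"
  unfolding weight_val_def
proof (rule some_equality)
  fix g
  assume "\<exists>p'\<in>S. \<exists>q'\<in>S. p' \<noteq> 0 \<and> q' \<noteq> 0 \<and> \<psi> p / \<psi> q = \<psi> p' / \<psi> q' \<and> g = weight W p' - weight W q'"
  then obtain p' q' where pq: "p' \<in> S" "q' \<in> S" "p' \<noteq> 0" "q' \<noteq> 0"
    "\<psi> p / \<psi> q = \<psi> p' / \<psi> q'" "g = weight W p' - weight W q'" by blast
  then have "\<psi> (p * q' - p' * q) = 0"
    using assms by (simp add: diff mult frac_eq_eq nz)
  \<comment> \<open>Injectivity of \<open>\<psi>\<close> on \<open>S\<close> lifts the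
    cross-multiplied identity to the ring, where weights add.\<close>
  then have "p * q' = p' * q"
    using inj0[of "p * q' - p' * q"] assms pq S by (auto intro: subring_diff subring_mult)
  then have "weight W p + weight W q' = weight W p' + weight W q"
    using assms pq weight_times by metis
  then show "g = weight W p - weight W q"
    using pq(6) by (metis add_diff_cancel_right' diff_add_eq diff_diff_eq2)
qed (use assms in blast)

lemma weight_val_image:
  assumes "p \<in> S" "p \<noteq> 0"
  shows "weight_val \<psi> S W (\<psi> p) = weight W p"
proof -
  have "W 0 = 0" using W_add[of 0 0] by simp
  then have "weight W (1 :: 'm \<Rightarrow>\<^sub>0 'c) = 0"
    by (metis single_one weight_single one_neq_zero)
  then show ?thesis
    using weight_val_frac[of p 1] assms subring_one[OF S] one by simp
qed

lemma fractionsE: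
  assumes "f \<in> fractions \<psi> S" "f \<noteq> 0"
  obtains p q where "p \<in> S" "q \<in> S" "p \<noteq> 0" "q \<noteq> 0" "f = \<psi> p / \<psi> q"
  using assms by (force simp: fractions_def zero)

lemma fractionsI: "p \<in> S \<Longrightarrow> q \<in> S \<Longrightarrow> q \<noteq> 0 \<Longrightarrow> \<psi> p / \<psi> q \<in> fractions \<psi> S"
  by (auto simp: fractions_def)

lemma image_in_fractions: "p \<in> S \<Longrightarrow> \<psi> p \<in> fractions \<psi> S"
  using fractionsI[of p 1] subring_one[OF S] one by simp

lemma psi_of_int: "\<psi> (of_int c) = of_int c"
proof -
  have *: "\<psi> (of_nat k) = of_nat k" for k
    by (induction k) (auto simp: zero one add)
  show ?thesis by (cases c rule: int_cases2) (auto simp: uminus *)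
qed

lemma fractions_subring: "is_subring (fractions \<psi> S)"
  unfolding is_subring_def
proof (intro conjI ballI)
  show "1 \<in> fractions \<psi> S"
    using image_in_fractions[OF subring_one[OF S]] one by simp
  fix f g assume "f \<in> fractions \<psi> S" "g \<in> fractions \<psi> S"
  then obtain p q p' q' where pq: "p \<in> S" "q \<in> S" "q \<noteq> 0" "f = \<psi> p / \<psi> q"
    "p' \<in> S" "q' \<in> S" "q' \<noteq> 0" "g = \<psi> p' / \<psi> q'" by (auto simp: fractions_def)
  have fg: "f - g = \<psi> (p * q' - p' * q) / \<psi> (q * q')" "f * g = \<psi> (p * p') / \<psi> (q * q')"
    using pq by (auto simp: diff mult nz diff_frac_eq)
  show "f - g \<in> fractions \<psi> S" "f * g \<in> fractions \<psi> S"
    unfolding fg using pq S no_zero_div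
    by (auto intro!: fractionsI intro: subring_diff subring_mult)
qed

sublocale subfield_valuation "fractions \<psi> S" "weight_val \<psi> S W"
proof
  show "is_subring (fractions \<psi> S)" by (rule fractions_subring)
next
  fix f assume "f \<in> fractions \<psi> S"
  then show "inverse f \<in> fractions \<psi> S"
    using image_in_fractions[OF subring_zero[OF S]] zero
    by (cases "f = 0") (auto elim!: fractionsE intro!: fractionsI)
next
  fix f g assume fg: "f \<in> fractions \<psi> S" "g \<in> fractions \<psi> S" "f \<noteq> 0" "g \<noteq> 0"
  obtain p q where pq: "p \<in> S" "q \<in> S" "p \<noteq> 0" "q \<noteq> 0" "f = \<psi> p / \<psi> q"
    using fg fractionsE by metis
  obtain p' q' where pq': "p' \<in> S" "q' \<in> S" "p' \<noteq> 0" "q' \<noteq> 0" "g = \<psi> p' / \<psi> q'"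
    using fg fractionsE by metis
  have S_mult: "a \<in> S \<Longrightarrow> b \<in> S \<Longrightarrow> a * b \<in> S" for a b
    using S subring_mult by blast
  have fg_mult: "f * g = \<psi> (p * p') / \<psi> (q * q')" using pq pq' by (simp add: mult)
  show "weight_val \<psi> S W (f * g) = weight_val \<psi> S W f + weight_val \<psi> S W g"
    unfolding fg_mult
    using pq pq' weight_val_frac[of p q] weight_val_frac[of p' q']
      weight_val_frac[OF S_mult S_mult no_zero_div no_zero_div, of p p' q q']
    by (simp add: weight_times)
  assume "f + g \<noteq> 0"
  have fg_add: "f + g = \<psi> (p * q' + p' * q) / \<psi> (q * q')"
    using pq pq' by (auto simp: add mult nz add_frac_eq)
  then have nz': "p * q' + p' * q \<noteq> 0" using \<open>f + g \<noteq> 0\<close> zero by auto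
  have "weight_val \<psi> S W (f + g) = weight W (p * q' + p' * q) - weight W (q * q')"
    unfolding fg_add using pq pq' S_mult no_zero_div nz' subring_add[OF S]
    by (intro weight_val_frac) auto
  also have "\<dots> \<le> max (weight W (p * q')) (weight W (p' * q)) - weight W (q * q')"
    using weight_add_le nz' pq pq' no_zero_div by (metis diff_right_mono)
  also have "\<dots> = max (weight_val \<psi> S W f) (weight_val \<psi> S W g)"
    using pq pq' by (auto simp: weight_val_frac weight_times max_def algebra_simps)
  finally show "weight_val \<psi> S W (f + g) \<le> max (weight_val \<psi> S W f) (weight_val \<psi> S W g)" .
next
  fix c :: int assume c: "c \<noteq> 0"
  have c': "(of_int c :: 'm \<Rightarrow>\<^sub>0 'c) = Poly_Mapping.single 0 (of_int c)" by simp
  have nz_c: "(of_int c :: 'm \<Rightarrow>\<^sub>0 'c) \<noteq> 0"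
    using char_0[OF c] by (metis c' lookup_single_eq lookup_zero)
  show "(of_int c :: 'k) \<noteq> 0"
    using nz[of "of_int c"] nz_c subring_of_int[OF S] psi_of_int by metis
  have "W 0 = 0" using W_add[of 0 0] by simp
  then show "weight_val \<psi> S W (of_int c) = 0"
    using weight_val_image[of "of_int c"] nz_c subring_of_int[OF S] psi_of_int[of c]
      weight_single[OF char_0[OF c], of W 0] by (metis c')
qed

end

section \<open>Laurent polynomials in a cluster\<close>

type_synonym 'v laurent = "('v \<Rightarrow>\<^sub>0 int) \<Rightarrow>\<^sub>0 int"

definition lmon :: "('v \<Rightarrow> 'k::field) \<Rightarrow> ('v \<Rightarrow>\<^sub>0 int) \<Rightarrow> 'k" where
  "lmon x m = (\<Prod>v\<in>Poly_Mapping.keys m. x v powi Poly_Mapping.lookup m v)"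

lemma lmon_superset:
  assumes "finite A" "Poly_Mapping.keys m \<subseteq> A"
  shows "lmon x m = (\<Prod>v\<in>A. x v powi Poly_Mapping.lookup m v)"
  unfolding lmon_def using assms by (intro prod.mono_neutral_left) (auto simp: in_keys_iff)

lemma lmon_0 [simp]: "lmon x 0 = 1"
  by (simp add: lmon_def)

lemma lmon_single: "lmon x (Poly_Mapping.single v c) = x v powi c"
  by (subst lmon_superset[of "{v}"]) auto

lemma lmon_single_1 [simp]: "lmon x (Poly_Mapping.single v 1) = x v"
  by (simp add: lmon_single)

lemma lmon_cong: "(\<And>v. v \<in> Poly_Mapping.keys m \<Longrightarrow> x v = y v) \<Longrightarrow> lmon x m = lmon y m"
  by (simp add: lmon_def)

lemma lmon_nz: "(\<And>v. x v \<noteq> 0) \<Longrightarrow> lmon x m \<noteq> 0"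
  by (simp add: lmon_def)

lemma lmon_add:
  assumes "\<And>v. x v \<noteq> 0"
  shows "lmon x (m + n) = lmon x m * lmon x n"
proof -
  let ?A = "Poly_Mapping.keys m \<union> Poly_Mapping.keys n"
  have "lmon x k = (\<Prod>v\<in>?A. x v powi Poly_Mapping.lookup k v)" if "k \<in> {m, n, m + n}" for k
    using that keys_add[of m n] by (intro lmon_superset) auto
  then show ?thesis
    using assms by (simp add: lookup_add power_int_add prod.distrib)
qed

lemma lmon_diff:
  assumes "\<And>v. x v \<noteq> 0"
  shows "lmon x (m - n) = lmon x m / lmon x n"
  using lmon_add[of x "m - n" n] lmon_nz[of x n] assms by (simp add: field_simps)

definition leval :: "('v \<Rightarrow> 'k::field) \<Rightarrow> 'v laurent \<Rightarrow> 'k" where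
  "leval x p = (\<Sum>m\<in>Poly_Mapping.keys p. of_int (Poly_Mapping.lookup p m) * lmon x m)"

lemma leval_superset:
  assumes "finite A" "Poly_Mapping.keys p \<subseteq> A"
  shows "leval x p = (\<Sum>m\<in>A. of_int (Poly_Mapping.lookup p m) * lmon x m)"
  unfolding leval_def using assms by (intro sum.mono_neutral_left) (auto simp: in_keys_iff)

lemma leval_0 [simp]: "leval x 0 = 0"
  by (simp add: leval_def)

lemma leval_single: "leval x (Poly_Mapping.single m c) = of_int c * lmon x m"
  by (subst leval_superset[of "{m}"]) auto

lemma leval_1 [simp]: "leval x 1 = 1"
  by (simp only: single_one[symmetric] leval_single lmon_0) simp

lemma leval_add: "leval x (p + q) = leval x p + leval x q"
proof -
  let ?A = "Poly_Mapping.keys p \<union> Poly_Mapping.keys q"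
  have "leval x r = (\<Sum>m\<in>?A. of_int (Poly_Mapping.lookup r m) * lmon x m)" if "r \<in> {p, q, p + q}" for r
    using that keys_add[of p q] by (intro leval_superset) auto
  then show ?thesis
    by (simp add: lookup_add distrib_right sum.distrib)
qed

lemma leval_sum: "leval x (sum f I) = (\<Sum>i\<in>I. leval x (f i))"
  by (induction I rule: infinite_finite_induct) (auto simp: leval_add)

lemma leval_mult:
  assumes "\<And>v. x v \<noteq> 0"
  shows "leval x (p * q) = leval x p * leval x q"
  unfolding mult_eq_sum_single[of p q] leval_sum leval_single
  by (simp add: leval_def sum_product lmon_add[OF assms] mult_ac)

lemma leval_diff: "leval x (p - q) = leval x p - leval x q"
  using leval_add[of x "p - q" q] by simp

definition supp_ring :: "'v set \<Rightarrow> 'v laurent set" where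
  "supp_ring V = {p. \<forall>m\<in>Poly_Mapping.keys p. Poly_Mapping.keys m \<subseteq> V}"

lemma single_in_supp_ring: "Poly_Mapping.keys m \<subseteq> V \<Longrightarrow> Poly_Mapping.single m c \<in> supp_ring V"
  by (auto simp: supp_ring_def)

lemma supp_ring_subring: "is_subring (supp_ring V)"
  unfolding is_subring_def
proof (intro conjI ballI)
  show "1 \<in> supp_ring V" by (simp add: supp_ring_def)
  fix p q assume pq: "p \<in> supp_ring V" "q \<in> supp_ring V"
  show "p - q \<in> supp_ring V"
    using pq keys_diff[of p q] by (auto simp: supp_ring_def)
  show "p * q \<in> supp_ring V"
    unfolding supp_ring_def
  proof (safe)
    fix m v assume m: "m \<in> Poly_Mapping.keys (p * q)" "v \<in> Poly_Mapping.keys m"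
    obtain a b where "m = a + b" "a \<in> Poly_Mapping.keys p" "b \<in> Poly_Mapping.keys q"
      using m(1) keys_mult[of p q] by auto
    then have "v \<in> Poly_Mapping.keys a \<or> v \<in> Poly_Mapping.keys b" "Poly_Mapping.keys a \<subseteq> V" "Poly_Mapping.keys b \<subseteq> V"
      using pq m(2) keys_add[of a b] unfolding supp_ring_def by blast+
    then show "v \<in> V" by blast
  qed
qed

definition laurent_ring :: "('v \<Rightarrow> 'k::field) \<Rightarrow> 'v set \<Rightarrow> 'k set" where
  "laurent_ring x V = leval x ` supp_ring V"

lemma laurent_ring_subring:
  assumes "\<And>v. x v \<noteq> 0"
  shows "is_subring (laurent_ring x V)"
proof -
  have "1 \<in> laurent_ring x V"
    using subring_one[OF supp_ring_subring] leval_1 by (force simp: laurent_ring_def)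
  moreover have "leval x p - leval x q \<in> laurent_ring x V" "leval x p * leval x q \<in> laurent_ring x V"
    if "p \<in> supp_ring V" "q \<in> supp_ring V" for p q
    using subring_diff[OF supp_ring_subring that] subring_mult[OF supp_ring_subring that]
    unfolding laurent_ring_def leval_mult[OF assms, symmetric] leval_diff[symmetric] by blast+
  ultimately show ?thesis
    by (auto simp: is_subring_def laurent_ring_def)
qed

lemma lmon_in_laurent_ring: "Poly_Mapping.keys m \<subseteq> V \<Longrightarrow> lmon x m \<in> laurent_ring x V"
  unfolding laurent_ring_def
  by (rule image_eqI[OF _ single_in_supp_ring[of m V 1]]) (simp_all add: leval_single)

text \<open>Meant for \<open>A\<close> the Laurent ring of another cluster, where the
  \<open>x v\<close> are elements but possibly not units: a power of their product clears all
  negative exponents.\<close>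

lemma laurent_ring_denominator:
  assumes nz: "\<And>v. x v \<noteq> 0" and V: "finite V" and f: "f \<in> laurent_ring x V"
    and A: "is_subring A" "\<And>v. v \<in> V \<Longrightarrow> x v \<in> A"
  shows "\<exists>N. (\<Prod>v\<in>V. x v) ^ N * f \<in> A"
proof -
  obtain p where p: "p \<in> supp_ring V" "f = leval x p"
    using f by (auto simp: laurent_ring_def)
  \<comment> \<open>The largest negated exponent that occurs; the inserted 0 covers an empty set of
    exponents and keeps \<open>nat\<close> from truncating.\<close>
  define N where "N = nat (Max (insert 0 ((\<lambda>(m, v). - Poly_Mapping.lookup m v) ` (Poly_Mapping.keys p \<times> V))))"
  have N: "0 \<le> int N + Poly_Mapping.lookup m v" if "m \<in> Poly_Mapping.keys p" "v \<in> V" for m v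
  proof -
    have "- Poly_Mapping.lookup m v \<le> Max (insert 0 ((\<lambda>(m, v). - Poly_Mapping.lookup m v) ` (Poly_Mapping.keys p \<times> V)))"
      using that V by (intro Max_ge) force+
    then show ?thesis by (simp add: N_def)
  qed
  have "(\<Prod>v\<in>V. x v) ^ N * lmon x m \<in> A" if m: "m \<in> Poly_Mapping.keys p" for m
  proof -
    have "Poly_Mapping.keys m \<subseteq> V" using p m by (auto simp: supp_ring_def)
    then have "(\<Prod>v\<in>V. x v) ^ N * lmon x m = (\<Prod>v\<in>V. x v ^ N * x v powi Poly_Mapping.lookup m v)"
      using V by (simp add: lmon_superset prod_power_distrib prod.distrib)
    also have "\<dots> = (\<Prod>v\<in>V. x v ^ nat (int N + Poly_Mapping.lookup m v))"
    proof (intro prod.cong refl)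
      fix v assume "v \<in> V"
      then have "x v ^ nat (int N + Poly_Mapping.lookup m v) = x v powi (int N + Poly_Mapping.lookup m v)"
        using N[OF m] by (simp add: power_int_def)
      then show "x v ^ N * x v powi Poly_Mapping.lookup m v = x v ^ nat (int N + Poly_Mapping.lookup m v)"
        using nz by (simp add: power_int_add)
    qed
    finally show ?thesis
      using A by (auto intro!: subring_prod subring_power)
  qed
  then have "(\<Sum>m\<in>Poly_Mapping.keys p. of_int (Poly_Mapping.lookup p m) * ((\<Prod>v\<in>V. x v) ^ N * lmon x m)) \<in> A"
    by (intro subring_sum[OF A(1)] subring_mult[OF A(1) subring_of_int[OF A(1)]])
  then show ?thesis
    by (intro exI[of _ N]) (simp add: p leval_def sum_distrib_left mult_ac)
qed

section \<open>Division of Laurent polynomials by binomials\<close>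

definition graded_part :: "(('v \<Rightarrow>\<^sub>0 int) \<Rightarrow> int) \<Rightarrow> int \<Rightarrow> 'v laurent \<Rightarrow> 'v laurent" where
  "graded_part l d p = (\<Sum>m\<in>{m\<in>Poly_Mapping.keys p. l m = d}. Poly_Mapping.single m (Poly_Mapping.lookup p m))"

lemma lookup_graded_part:
  "Poly_Mapping.lookup (graded_part l d p) m = (if l m = d then Poly_Mapping.lookup p m else 0)"
  by (auto simp: graded_part_def lookup_sum lookup_single when_def sum.delta in_keys_iff)

lemma graded_part_in_supp_ring: "p \<in> supp_ring V \<Longrightarrow> graded_part l d p \<in> supp_ring V"
  by (auto simp: supp_ring_def in_keys_iff lookup_graded_part split: if_splits)

lemma lookup_single_1_mult:
  fixes p :: "'v laurent"
  shows "Poly_Mapping.lookup (Poly_Mapping.single a 1 * p) k = Poly_Mapping.lookup p (k - a)"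
proof -
  have "Poly_Mapping.lookup (Poly_Mapping.single a 1 * p) k
      = (\<Sum>b\<in>Poly_Mapping.keys p. if b = k - a then Poly_Mapping.lookup p b else 0)"
    by (subst mult_eq_sum_single)
      (auto simp: lookup_sum lookup_single when_def algebra_simps intro!: sum.cong)
  then show ?thesis by (simp add: sum.delta in_keys_iff)
qed

lemma graded_part_binomial_mult:
  assumes "\<And>m n. l (m + n) = l m + l n"
  shows "graded_part l d ((1 + Poly_Mapping.single a 1) * p)
    = graded_part l d p + Poly_Mapping.single a 1 * graded_part l (d - l a) p"
proof (rule poly_mapping_eqI)
  fix k
  have "l k = l (k - a) + l a" using assms[of "k - a" a] by simp
  then show "Poly_Mapping.lookup (graded_part l d ((1 + Poly_Mapping.single a 1) * p)) k
    = Poly_Mapping.lookup (graded_part l d p + Poly_Mapping.single a 1 * graded_part l (d - l a) p) k"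
    by (auto simp: lookup_graded_part lookup_add lookup_single_1_mult distrib_right)
qed

text \<open>The first binomial is homogeneous for the grading and the second one has a unit as its
  lowest part, so divisibility passes to the graded parts of \<open>h\<close> one degree after the other.\<close>

lemma binomial_dvd_cancel_pos:
  fixes h g :: "'v laurent"
  assumes l: "\<And>m n. l (m + n) = l m + l n" "l a = (0::int)" "l c > 0"
    and V: "Poly_Mapping.keys a \<subseteq> V" "Poly_Mapping.keys c \<subseteq> V" "h \<in> supp_ring V" "g \<in> supp_ring V"
    and eq: "(1 + Poly_Mapping.single c 1) * h = (1 + Poly_Mapping.single a 1) * g"
  shows "\<exists>k\<in>supp_ring V. h = (1 + Poly_Mapping.single a 1) * k"
proof -
  let ?A = "1 + Poly_Mapping.single a 1 :: 'v laurent" and ?C = "Poly_Mapping.single c 1 :: 'v laurent"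
  define D where "D = l ` Poly_Mapping.keys h"
  have D: "finite D" by (simp add: D_def)
  have notD: "graded_part l d h = 0" if "d \<notin> D" for d
    using that by (intro poly_mapping_eqI) (auto simp: lookup_graded_part D_def in_keys_iff)
  define d0 where "d0 = Min (insert 0 D)"
  have low: "graded_part l d h = 0" if "d < d0" for d
    using that D Min_le[of "insert 0 D" d] by (intro notD) (auto simp: d0_def)
  note closed = subring_mult[OF supp_ring_subring] subring_diff[OF supp_ring_subring]
    subring_sum[OF supp_ring_subring] subring_zero[OF supp_ring_subring]
  \<comment> \<open>The part of degree \<open>d\<close> of \<open>eq\<close>: multiplication by the
    monomial of \<open>c\<close> shifts degrees by \<open>l c\<close>, by that of \<open>a\<close>
    it keeps them.\<close>
  have step: "graded_part l d h = ?A * graded_part l d g - ?C * graded_part l (d - l c) h" for d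
    using arg_cong[OF eq, of "graded_part l d"] graded_part_binomial_mult[OF l(1), of d c h]
      graded_part_binomial_mult[OF l(1), of d a g] l(2)
    by (simp add: algebra_simps)
  have "\<exists>k\<in>supp_ring V. graded_part l d h = ?A * k" for d
  proof (induction "nat (d - d0)" arbitrary: d rule: less_induct)
    case less
    show ?case
    proof (cases "d < d0")
      case True
      then show ?thesis using low closed(4) mult_zero_right by metis
    next
      case False
      \<comment> \<open>\<open>nat\<close> identifies all degrees up to \<open>d0\<close>, so a drop
        below \<open>d0\<close> is a separate case, in which the part is zero.\<close>
      have "nat (d - l c - d0) < nat (d - d0) \<or> d - l c < d0"
        using False l(3) by auto
      then have "\<exists>k\<in>supp_ring V. graded_part l (d - l c) h = ?A * k"
        using less[of "d - l c"] low[of "d - l c"] closed(4) mult_zero_right by metis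
      then obtain k where k: "k \<in> supp_ring V" "graded_part l (d - l c) h = ?A * k" by blast
      have "graded_part l d h = ?A * (graded_part l d g - ?C * k)"
        using step[of d] k(2) by (simp add: algebra_simps)
      moreover have "graded_part l d g - ?C * k \<in> supp_ring V"
        using V k(1) by (intro closed(1,2) graded_part_in_supp_ring single_in_supp_ring)
      ultimately show ?thesis by blast
    qed
  qed
  then obtain k where k: "k d \<in> supp_ring V" "graded_part l d h = ?A * k d" for d
    by metis
  have "h = (\<Sum>d\<in>D. graded_part l d h)"
    by (rule poly_mapping_eqI)
      (auto simp: lookup_sum lookup_graded_part D sum.delta' D_def image_iff in_keys_iff)
  also have "\<dots> = ?A * sum k D"
    by (simp add: k sum_distrib_left)
  finally have "h = ?A * sum k D" .
  moreover have "sum k D \<in> supp_ring V" using k(1) by (intro closed(3))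
  ultimately show ?thesis by blast
qed

lemma binomial_dvd_cancel:
  fixes h g :: "'v laurent"
  assumes l: "\<And>m n. l (m + n) = l m + l n" "l a = (0::int)" "l c \<noteq> 0"
    and V: "Poly_Mapping.keys a \<subseteq> V" "Poly_Mapping.keys c \<subseteq> V" "h \<in> supp_ring V" "g \<in> supp_ring V"
    and eq: "(1 + Poly_Mapping.single c 1) * h = (1 + Poly_Mapping.single a 1) * g"
  shows "\<exists>k\<in>supp_ring V. h = (1 + Poly_Mapping.single a 1) * k"
proof (cases "l c > 0")
  case True
  then show ?thesis using binomial_dvd_cancel_pos[of l a c V h g] assms by blast
next
  case False
  then show ?thesis using binomial_dvd_cancel_pos[of "\<lambda>m. - l m" a c V h g] assms by simp
qed

text \<open>The values of the variables are linearly independent over the integers. Nonvanishing is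
  asked for all \<open>v\<close>, also outside \<open>V\<close>, so that \<open>lmon\<close> is
  multiplicative without conditions on supports.\<close>

definition (in subfield_valuation) independent :: "('v \<Rightarrow> 'k) \<Rightarrow> 'v set \<Rightarrow> bool" where
  "independent x V \<longleftrightarrow> (\<forall>v. x v \<noteq> 0) \<and> (\<forall>v\<in>V. x v \<in> R) \<and>
     (\<forall>m. Poly_Mapping.keys m \<subseteq> V \<longrightarrow> val (lmon x m) = 0 \<longrightarrow> m = 0)"

context subfield_valuation
begin

lemma lmon_in:
  assumes "\<And>v. v \<in> V \<Longrightarrow> x v \<in> R" "Poly_Mapping.keys m \<subseteq> V"
  shows "lmon x m \<in> R"
  unfolding lmon_def using assms by (intro R_closed power_int_in) auto

context
  fixes x :: "'v \<Rightarrow> 'k" and V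
  assumes ind: "independent x V"
begin

lemma independent_nz: "x v \<noteq> 0"
  using ind by (simp add: independent_def)

lemma independent_in: "Poly_Mapping.keys m \<subseteq> V \<Longrightarrow> lmon x m \<in> R"
  using ind lmon_in[of V x m] by (auto simp: independent_def)

lemma independent_val_eq:
  assumes "Poly_Mapping.keys m \<subseteq> V" "Poly_Mapping.keys n \<subseteq> V" "val (lmon x m) = val (lmon x n)"
  shows "m = n"
proof -
  have "val (lmon x (m - n)) = 0"
    using assms by (simp add: lmon_diff independent_nz val_divide independent_in lmon_nz)
  moreover have "Poly_Mapping.keys (m - n) \<subseteq> V"
    using assms keys_diff[of m n] by auto
  ultimately show ?thesis using ind by (auto simp: independent_def)
qed

text \<open>Distinct exponents have distinct values, so terms cannot cancel. Uniqueness of Laurent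
  expansions, \<open>leval_inj\<close>, is a consequence.\<close>

lemma val_leval:
  assumes p: "p \<in> supp_ring V" "p \<noteq> 0"
  shows "leval x p \<noteq> 0" "leval x p \<in> R" "val (leval x p) = Max ((\<lambda>m. val (lmon x m)) ` Poly_Mapping.keys p)"
proof -
  let ?f = "\<lambda>m. of_int (Poly_Mapping.lookup p m) * lmon x m"
  have keys: "Poly_Mapping.keys m \<subseteq> V" if "m \<in> Poly_Mapping.keys p" for m
    using p that by (auto simp: supp_ring_def)
  have f: "?f m \<noteq> 0" "?f m \<in> R" "val (?f m) = val (lmon x m)" if "m \<in> Poly_Mapping.keys p" for m
    using that keys[OF that] of_int_nz lmon_nz[of x m]
    by (auto simp: independent_nz in_keys_iff val_mult val_of_int R_closed independent_in)
  have "sum ?f (Poly_Mapping.keys p) \<noteq> 0 \<and> val (sum ?f (Poly_Mapping.keys p)) = Max ((\<lambda>m. val (?f m)) ` Poly_Mapping.keys p)"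
  proof (rule val_sum_distinct)
    show "inj_on (\<lambda>m. val (?f m)) (Poly_Mapping.keys p)"
    proof (rule inj_onI)
      fix m n assume mn: "m \<in> Poly_Mapping.keys p" "n \<in> Poly_Mapping.keys p" "val (?f m) = val (?f n)"
      then show "m = n" using independent_val_eq[OF keys keys] f(3) by metis
    qed
  qed (use p f in auto)
  then show "leval x p \<noteq> 0" "val (leval x p) = Max ((\<lambda>m. val (lmon x m)) ` Poly_Mapping.keys p)"
    using f by (auto simp: leval_def cong: image_cong_simp)
  show "leval x p \<in> R" unfolding leval_def using f(2) by (intro subring_sum[OF subring])
qed

lemma leval_inj:
  assumes "p \<in> supp_ring V" "q \<in> supp_ring V" "leval x p = leval x q"
  shows "p = q"
  using val_leval(1)[of "p - q"] subring_diff[OF supp_ring_subring assms(1,2)] assms(3)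
  by (auto simp: leval_diff)

lemma binomial_coprime:
  assumes l: "\<And>m n. l (m + n) = l m + l n" "l a = (0::int)" "l c \<noteq> 0"
    and V: "Poly_Mapping.keys a \<subseteq> V" "Poly_Mapping.keys c \<subseteq> V" "h \<in> laurent_ring x V" "g \<in> laurent_ring x V"
    and eq: "(1 + lmon x c) * h = (1 + lmon x a) * g"
  shows "\<exists>k\<in>laurent_ring x V. h = (1 + lmon x a) * k"
proof -
  obtain p q where pq: "p \<in> supp_ring V" "h = leval x p" "q \<in> supp_ring V" "g = leval x q"
    using V by (auto simp: laurent_ring_def)
  have binom: "leval x ((1 + Poly_Mapping.single b 1) * r) = (1 + lmon x b) * leval x r" for b r
    by (simp add: leval_mult independent_nz leval_add leval_single)
  have closed: "(1 + Poly_Mapping.single b 1) * r \<in> supp_ring V"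
    if "Poly_Mapping.keys b \<subseteq> V" "r \<in> supp_ring V" for b r
    using that supp_ring_subring single_in_supp_ring
    by (intro subring_mult subring_add subring_one) auto
  have "(1 + Poly_Mapping.single c 1) * p = (1 + Poly_Mapping.single a 1) * q"
    using eq pq V closed by (intro leval_inj) (auto simp: binom)
  from binomial_dvd_cancel[OF l V(1,2) pq(1,3) this]
  obtain k where "k \<in> supp_ring V" "p = (1 + Poly_Mapping.single a 1) * k" by blast
  then show ?thesis
    using binom pq(2) by (auto simp: laurent_ring_def)
qed

end

end

section \<open>Mutation\<close>

text \<open>The last conjunct is full column rank of the extended exchange matrix. Integer vectors
  \<open>c\<close> detect rational dependences after clearing denominators.\<close>

definition skew_full_rank :: "'v seed \<Rightarrow> bool" where
  "skew_full_rank s \<longleftrightarrow> finite (vertices s) \<and> (\<forall>a b. mult s a b = - mult s b a) \<and>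
     (\<forall>c. (\<forall>a\<in>vertices s. (\<Sum>v\<in>mutable s. mult s a v * c v) = 0) \<longrightarrow> (\<forall>v\<in>mutable s. c v = 0))"

lemma mutate_simps [simp]:
  "frozen (mutate v s) = frozen s" "mutable (mutate v s) = mutable s" "vertices (mutate v s) = vertices s"
  "mult (mutate v s) = mutate_mult s v" "cvar (mutate v s) = (cvar s)(v := mutate_var s v)"
  by (simp_all add: mutate_def vertices_def)

context
  fixes s :: "'v seed"
  assumes skew: "\<And>a b. mult s a b = - mult s b a"
begin

lemma mult_self: "mult s a a = 0"
  using skew[of a a] by simp

lemma mutate_mult_skew: "mutate_mult s v a b = - mutate_mult s v b a"
proof -
  have "\<not> (a \<in> In s v \<and> a \<in> Out s v)" for a
    using skew[of a v] by (auto simp: In_def Out_def)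
  then show ?thesis
    using skew[of a b] by (auto simp: mutate_mult_def)
qed

lemma mutate_mult_incident: "mutate_mult s v a v = - mult s a v" "mutate_mult s v v a = - mult s v a"
  by (simp_all add: mutate_mult_def)

text \<open>The matrix form of mutation in terms of positive and negative parts. One formula for all
  directions of the arrows makes the later rank computation linear.\<close>

lemma mutate_mult_other:
  assumes "a \<in> vertices s" "b \<in> vertices s" "a \<noteq> v" "b \<noteq> v"
  shows "mutate_mult s v a b = mult s a b
    + max 0 (mult s a v) * max 0 (mult s v b) - max 0 (- mult s a v) * max 0 (- mult s v b)"
  using assms skew[of b v] skew[of v a] skew[of b a]
  by (auto simp: mutate_mult_def In_def Out_def max_def)

lemma In_mutate: "In (mutate v s) v = Out s v" and Out_mutate: "Out (mutate v s) v = In s v"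
proof -
  have "mult s v a > 0 \<longleftrightarrow> mult s a v < 0" "mult s v a < 0 \<longleftrightarrow> mult s a v > 0" for a
    using skew[of v a] by simp_all
  then show "In (mutate v s) v = Out s v" "Out (mutate v s) v = In s v"
    by (auto simp: In_def Out_def mutate_mult_incident)
qed

text \<open>The first mutation exchanges \<open>In\<close> and \<open>Out\<close> at
  \<open>v\<close>, so the second one subtracts exactly the products that the first one
  added.\<close>

lemma mutate_mult_mutate: "mutate_mult (mutate v s) v a b = mult s a b"
proof -
  have disj: "\<not> (c \<in> In s v \<and> c \<in> Out s v)" for c
    using skew[of c v] by (auto simp: In_def Out_def)
  have eqs: "mult s v b = - mult s b v" "mult s v a = - mult s a v" and ab: "mult s a b = - mult s b a"
    by (fact skew)+
  show ?thesis
  proof (cases "a = v \<or> b = v")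
    case True
    then show ?thesis by (auto simp: mutate_mult_def)
  next
    case False
    then have "a \<noteq> v" "b \<noteq> v" by auto
    then show ?thesis
      using disj[of a] disj[of b] ab
      unfolding mutate_mult_def[of "mutate v s"] In_mutate Out_mutate mutate_simps
      unfolding mutate_mult_def eqs
      by (cases "a \<in> In s v"; cases "b \<in> In s v"; cases "a \<in> Out s v"; cases "b \<in> Out s v"; simp)
  qed
qed

lemma prod_In:
  assumes "finite (vertices s)"
  shows "(\<Prod>a\<in>In s v. y a ^ nat (mult s a v)) = (\<Prod>a\<in>vertices s. y a ^ nat (mult s a v))"
    and "(\<Prod>a\<in>Out s v. y a ^ nat (mult s v a)) = (\<Prod>a\<in>vertices s. y a ^ nat (- mult s a v))"
proof -
  show "(\<Prod>a\<in>In s v. y a ^ nat (mult s a v)) = (\<Prod>a\<in>vertices s. y a ^ nat (mult s a v))"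
    using assms by (intro prod.mono_neutral_left ballI) (auto simp: In_def not_less)
  have "(\<Prod>a\<in>Out s v. y a ^ nat (mult s v a)) = (\<Prod>a\<in>vertices s. y a ^ nat (mult s v a))"
    using assms by (intro prod.mono_neutral_left ballI) (auto simp: Out_def not_less)
  then show "(\<Prod>a\<in>Out s v. y a ^ nat (mult s v a)) = (\<Prod>a\<in>vertices s. y a ^ nat (- mult s a v))"
    using arg_cong[OF skew[of v], of nat] by (simp only:)
qed

lemma mutate_var_eq:
  assumes "finite (vertices s)"
  shows "mutate_var s v = ((\<Prod>a\<in>vertices s. cvar s a ^ nat (mult s a v))
    + (\<Prod>a\<in>vertices s. cvar s a ^ nat (- mult s a v))) / cvar s v"
  by (simp add: mutate_var_def prod_In[OF assms])

text \<open>The exchange relation is symmetric in the old and the new variable, since reversing the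
  arrows at \<open>v\<close> swaps its two products. A nonzero new variable lets the second division
  undo the first.\<close>

lemma mutate_mutate:
  assumes nz: "mutate_var s v \<noteq> 0"
  shows "mutate v (mutate v s) = s"
proof -
  have notin: "v \<notin> In s v" "v \<notin> Out s v" by (auto simp: In_def Out_def mult_self)
  have sw: "nat (- mult s a v) = nat (mult s v a)" "nat (- mult s v a) = nat (mult s a v)" for a
    using skew[of v a] by simp_all
  have "(\<Prod>a\<in>Out s v. cvar (mutate v s) a ^ nat (mult (mutate v s) a v)) = (\<Prod>a\<in>Out s v. cvar s a ^ nat (mult s v a))"
    "(\<Prod>a\<in>In s v. cvar (mutate v s) a ^ nat (mult (mutate v s) v a)) = (\<Prod>a\<in>In s v. cvar s a ^ nat (mult s a v))"
    using notin sw by (auto intro!: prod.cong simp: mutate_mult_incident)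
  then have "mutate_var (mutate v s) v = cvar s v"
    using nz unfolding mutate_var_def[of "mutate v s"] In_mutate Out_mutate
    by (simp add: mutate_var_def add.commute)
  moreover have "mutate_mult (mutate v s) v = mult s"
    using mutate_mult_mutate by blast
  ultimately show ?thesis
    by (simp add: mutate_def[of v "mutate v s"])
qed

end

lemma skew_full_rankD:
  assumes "skew_full_rank s"
  shows "finite (vertices s)" "mult s a b = - mult s b a"
  using assms unfolding skew_full_rank_def by blast+

lemma skew_full_rank_kernel:
  assumes "skew_full_rank s" "\<And>a. a \<in> vertices s \<Longrightarrow> (\<Sum>v\<in>mutable s. mult s a v * c v) = 0" "v \<in> mutable s"
  shows "c v = 0"
  using assms unfolding skew_full_rank_def by blast

text \<open>A kernel vector of the mutated matrix becomes one of the original matrix by a change of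
  its coordinate at \<open>k\<close> alone.\<close>

lemma skew_full_rank_mutate:
  assumes s: "skew_full_rank s" and k: "k \<in> mutable s"
  shows "skew_full_rank (mutate k s)"
proof -
  note skew = skew_full_rankD(2)[OF s]
  have kV: "k \<in> vertices s" using k by (simp add: vertices_def)
  have fin: "finite (mutable s)" using skew_full_rankD(1)[OF s] by (simp add: vertices_def)
  have "c v = 0" if v: "v \<in> mutable s"
    and c: "\<And>a. a \<in> vertices s \<Longrightarrow> (\<Sum>v\<in>mutable s. mutate_mult s k a v * c v) = 0" for c v
  proof -
    let ?M = "mutable s - {k}"
    \<comment> \<open>The new coordinate at \<open>k\<close> collects everything that row
      \<open>a\<close> of the mutated matrix contributes with the factor
      \<open>mult s a k\<close>.\<close>
    define d where "d = c(k := - c k + (\<Sum>v\<in>?M. max 0 (- mult s k v) * c v))"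
    have split: "(\<Sum>v\<in>mutable s. f v) = f k + (\<Sum>v\<in>?M. f v)" for f :: "'a \<Rightarrow> int"
      using fin k by (simp add: sum.remove)
    \<comment> \<open>Row \<open>k\<close> only changes sign under mutation. This relation removes
      the terms with the factor \<open>max 0 (mult s a k)\<close> from the other rows.\<close>
    have row_k: "(\<Sum>v\<in>?M. mult s k v * c v) = 0"
      using c[OF kV] unfolding split
      by (simp add: mutate_mult_incident[OF skew] mult_self[OF skew] sum_negf)
    have "(\<Sum>v\<in>mutable s. mult s a v * d v) = 0" if a: "a \<in> vertices s" for a
    proof (cases "a = k")
      case True
      then show ?thesis unfolding split
        using row_k by (simp add: mult_self[OF skew] d_def)
    next
      case False
      \<comment> \<open>The matrix formula with the positive part of \<open>mult s k v\<close>
        written as \<open>mult s k v\<close> plus its negative part.\<close>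
      have "mutate_mult s k a v = mult s a v + max 0 (mult s a k) * mult s k v + mult s a k * max 0 (- mult s k v)"
        if "v \<in> ?M" for v
        using that False a by (subst mutate_mult_other[OF skew]) (auto simp: vertices_def max_def algebra_simps)
      then have "0 = - mult s a k * c k + (\<Sum>v\<in>?M. (mult s a v + max 0 (mult s a k) * mult s k v
          + mult s a k * max 0 (- mult s k v)) * c v)"
        using c[OF a] unfolding split by (simp add: mutate_mult_incident[OF skew])
      also have "\<dots> = - mult s a k * c k + (\<Sum>v\<in>?M. mult s a v * c v)
          + max 0 (mult s a k) * (\<Sum>v\<in>?M. mult s k v * c v)
          + mult s a k * (\<Sum>v\<in>?M. max 0 (- mult s k v) * c v)"
        by (simp add: sum.distrib sum_distrib_left algebra_simps)
      finally show ?thesis unfolding split row_k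
        by (simp add: d_def algebra_simps)
    qed
    then have d0: "d w = 0" if "w \<in> mutable s" for w
      using skew_full_rank_kernel[OF s] that by blast
    have c0: "c w = 0" if "w \<in> ?M" for w
      using d0[of w] that by (auto simp: d_def)
    moreover have "c k = 0"
      using d0[OF k] c0 by (simp add: d_def)
    ultimately show "c v = 0" using v by blast
  qed
  then show ?thesis
    unfolding skew_full_rank_def mutate_simps
    using mutate_mult_skew[OF skew] skew_full_rankD(1)[OF s] by blast
qed

text \<open>The nonzero minor will serve as a linear form on exponents that vanishes on one column
  but not on the other.\<close>

lemma two_columns_independent:
  assumes s: "skew_full_rank s" and ij: "i \<in> mutable s" "j \<in> mutable s" "i \<noteq> j"
  obtains p q where "p \<in> vertices s" "q \<in> vertices s"
    "mult s p i * mult s q j \<noteq> mult s q i * mult s p j"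
proof -
  have fin: "finite (mutable s)" using skew_full_rankD(1)[OF s] by (simp add: vertices_def)
  have two: "\<alpha> = 0 \<and> \<beta> = 0" if "\<And>a. a \<in> vertices s \<Longrightarrow> mult s a i * \<alpha> + mult s a j * \<beta> = 0" for \<alpha> \<beta>
  proof -
    define c where "c = (\<lambda>v. if v = i then \<alpha> else if v = j then \<beta> else 0)"
    have "(\<Sum>v\<in>mutable s. mult s a v * c v) = 0" if "a \<in> vertices s" for a
    proof -
      have "(\<Sum>v\<in>mutable s. mult s a v * c v) = (\<Sum>v\<in>{i, j}. mult s a v * c v)"
        using ij fin by (intro sum.mono_neutral_right) (auto simp: c_def)
      then show ?thesis using \<open>\<And>a. a \<in> vertices s \<Longrightarrow> mult s a i * \<alpha> + mult s a j * \<beta> = 0\<close>[OF that] ij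
        by (simp add: c_def)
    qed
    then have "c i = 0" "c j = 0" using skew_full_rank_kernel[OF s] ij by blast+
    then show ?thesis using ij by (simp add: c_def)
  qed
  obtain p where p: "p \<in> vertices s" "mult s p i \<noteq> 0"
    using two[of 1 0] by auto
  \<comment> \<open>This combination of the two columns vanishes in row \<open>p\<close>; as its
    coefficients are not both zero, some other row detects it.\<close>
  obtain q where "q \<in> vertices s" "mult s q i * (- mult s p j) + mult s q j * mult s p i \<noteq> 0"
    using two[of "- mult s p j" "mult s p i"] p(2) by blast
  then show thesis using that[of p q] p by (simp add: algebra_simps)
qed

lemma column_nonzero:
  assumes s: "skew_full_rank s" and "i \<in> mutable s"
  obtains p where "p \<in> vertices s" "mult s p i \<noteq> 0"
proof -
  have fin: "finite (mutable s)" using skew_full_rankD(1)[OF s] by (simp add: vertices_def)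
  have "\<exists>p\<in>vertices s. mult s p i \<noteq> 0"
  proof (rule ccontr)
    assume "\<not> ?thesis"
    then have "(\<Sum>v\<in>mutable s. mult s a v * of_bool (v = i)) = 0" if "a \<in> vertices s" for a
      using that by (intro sum.neutral) auto
    then have "of_bool (i = i) = (0 :: int)" using skew_full_rank_kernel[OF s, of "\<lambda>v. of_bool (v = i)"] assms by blast
    then show False by simp
  qed
  then show thesis using that by blast
qed

text \<open>Reversing every arrow leaves the exchange relations as they are, which reduces arrows
  from \<open>j\<close> to \<open>i\<close> to arrows from \<open>i\<close> to
  \<open>j\<close>.\<close>

definition opposite :: "'v seed \<Rightarrow> 'v seed" where
  "opposite s = s\<lparr>mult := \<lambda>a b. mult s b a\<rparr>"

lemma opposite_simps [simp]:
  "frozen (opposite s) = frozen s" "mutable (opposite s) = mutable s" "vertices (opposite s) = vertices s"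
  "mult (opposite s) a b = mult s b a" "cvar (opposite s) = cvar s"
  by (simp_all add: opposite_def vertices_def)

lemma skew_full_rank_opposite:
  assumes s: "skew_full_rank s"
  shows "skew_full_rank (opposite s)"
proof -
  have flip: "(\<Sum>v\<in>mutable s. mult s v a * c v) = - (\<Sum>v\<in>mutable s. mult s a v * c v)" for a and c :: "_ \<Rightarrow> int"
    unfolding sum_negf[symmetric] using skew_full_rankD(2)[OF s, of _ a]
    by (intro sum.cong refl) (metis mult_minus_left)
  show ?thesis
    using s unfolding skew_full_rank_def opposite_simps flip neg_equal_0_iff_equal by blast
qed

lemma mutate_opposite:
  assumes "skew_full_rank s"
  shows "mutate v (opposite s) = opposite (mutate v s)"
proof -
  have io: "In (opposite s) v = Out s v" "Out (opposite s) v = In s v"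
    by (auto simp: In_def Out_def)
  have "mutate_mult (opposite s) v a b = mutate_mult s v b a" for a b
    unfolding mutate_mult_def io by auto
  moreover have "mutate_var (opposite s) v = mutate_var s v"
    by (simp add: mutate_var_def io add.commute)
  ultimately show ?thesis
    by (simp add: mutate_def[of v "opposite s"] opposite_def[of "mutate v s"])
      (simp add: mutate_def opposite_def fun_eq_iff)
qed

section \<open>Powers of monomials, exponent vectors and mutation of valued seeds\<close>

lemma prod_power_int: "(\<Prod>v\<in>A. f v) powi n = (\<Prod>v\<in>A. f v powi n)" for f :: "'v \<Rightarrow> 'k::field"
  by (induction A rule: infinite_finite_induct) (auto simp: power_int_mult_distrib)

lemma lmon_cmul: "lmon x (frag_cmul n m) = lmon x m powi n"
proof -
  have "lmon x (frag_cmul n m) = (\<Prod>v\<in>Poly_Mapping.keys m. x v powi Poly_Mapping.lookup (frag_cmul n m) v)"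
    by (intro lmon_superset) (auto dest: keys_cmul[THEN subsetD])
  also have "\<dots> = (\<Prod>v\<in>Poly_Mapping.keys m. (x v powi Poly_Mapping.lookup m v) powi n)"
    by (intro prod.cong refl) (simp add: mult.commute flip: power_int_mult)
  finally show ?thesis
    by (simp add: lmon_def prod_power_int)
qed

definition exponent :: "'v set \<Rightarrow> ('v \<Rightarrow> int) \<Rightarrow> 'v \<Rightarrow>\<^sub>0 int" where
  "exponent A f = (\<Sum>a\<in>A. Poly_Mapping.single a (f a))"

lemma lookup_exponent: "finite A \<Longrightarrow> Poly_Mapping.lookup (exponent A f) a = (if a \<in> A then f a else 0)"
  by (auto simp: exponent_def lookup_sum lookup_single when_def sum.delta)

lemma keys_exponent: "finite A \<Longrightarrow> Poly_Mapping.keys (exponent A f) \<subseteq> A"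
  by (auto simp: in_keys_iff lookup_exponent split: if_splits)

lemma lmon_exponent: "finite A \<Longrightarrow> lmon x (exponent A f) = (\<Prod>a\<in>A. x a powi f a)"
  by (subst lmon_superset[of A]) (auto simp: keys_exponent lookup_exponent)

locale seed_valuation = subfield_valuation R val
  for R :: "ratfun set" and val :: "ratfun \<Rightarrow> 'g::linordered_ab_group_add"
begin

definition admissible :: "'v seed \<Rightarrow> bool" where
  "admissible s \<longleftrightarrow> skew_full_rank s \<and> independent (cvar s) (vertices s)"

text \<open>As far as values are concerned, the mutation is a substitution of monomials that changes
  the exponent lattice invertibly, so distinct exponents keep distinct values.\<close>

lemma mutate_var_nz_independent:
  assumes "admissible s" "k \<in> mutable s"
  shows "mutate_var s k \<noteq> 0" "independent (cvar (mutate k s)) (vertices s)"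
proof -
  have s: "skew_full_rank s" and ind: "independent (cvar s) (vertices s)"
    using assms by (auto simp: admissible_def)
  note skew = skew_full_rankD(2)[OF s]
  let ?V = "vertices s" and ?x = "cvar s"
  have V: "finite ?V" "k \<in> ?V" using skew_full_rankD(1)[OF s] assms(2) by (auto simp: vertices_def)
  note nz = independent_nz[OF ind]
  \<comment> \<open>For \<open>\<epsilon>\<close> equal to 1 and -1, the exponents of the two terms
    of the exchange relation after division by the old variable. The quiver has no loops, so the
    coordinate at \<open>k\<close> is -1.\<close>
  define e where "e \<epsilon> = exponent ?V (\<lambda>a. int (nat (\<epsilon> * mult s a k))) - Poly_Mapping.single k 1" for \<epsilon>
  have e: "Poly_Mapping.keys (e \<epsilon>) \<subseteq> ?V" "Poly_Mapping.lookup (e \<epsilon>) k = - 1" for \<epsilon>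
    using V keys_diff[of "exponent ?V (\<lambda>a. int (nat (\<epsilon> * mult s a k)))" "Poly_Mapping.single k 1"]
      keys_exponent[OF V(1)]
    by (force simp: e_def, simp add: e_def lookup_minus lookup_exponent mult_self[OF skew])
  have lmon_e: "lmon ?x (e \<epsilon>) = (\<Prod>a\<in>?V. ?x a ^ nat (\<epsilon> * mult s a k)) / ?x k" for \<epsilon>
    by (simp only: e_def lmon_diff[OF nz] lmon_single_1 lmon_exponent[OF V(1)] power_int_of_nat)
  have var: "mutate_var s k = lmon ?x (e 1) + lmon ?x (e (-1))"
    unfolding lmon_e mutate_var_eq[OF skew V(1)] by (simp add: add_divide_distrib)
  obtain p where p: "p \<in> ?V" "mult s p k \<noteq> 0" using column_nonzero[OF s assms(2)] .
  then have "p \<noteq> k" using mult_self[OF skew] by auto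
  then have "Poly_Mapping.lookup (e 1) p \<noteq> Poly_Mapping.lookup (e (-1)) p"
    using p V by (auto simp: e_def lookup_minus lookup_exponent lookup_single)
  then have "val (lmon ?x (e 1)) \<noteq> val (lmon ?x (e (-1)))"
    using independent_val_eq[OF ind e(1) e(1)] by metis
  then have sum: "mutate_var s k \<noteq> 0" "val (mutate_var s k) = max (val (lmon ?x (e 1))) (val (lmon ?x (e (-1))))"
    unfolding var using val_add_neq independent_in[OF ind e(1)] lmon_nz[of ?x] nz by blast+
  show "mutate_var s k \<noteq> 0" by (fact sum)
  obtain \<epsilon> where \<epsilon>: "val (mutate_var s k) = val (lmon ?x (e \<epsilon>))"
    using sum(2) by (auto simp: max_def split: if_splits)
  have inR: "mutate_var s k \<in> R"
    unfolding var by (intro R_closed independent_in[OF ind] e)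
  let ?y = "cvar (mutate k s)"
  show "independent ?y ?V"
    unfolding independent_def
  proof (intro conjI allI ballI impI)
    show "?y v \<noteq> 0" for v using nz sum(1) by simp
    show "?y v \<in> R" if "v \<in> ?V" for v using ind inR that by (auto simp: independent_def)
    fix m assume m: "Poly_Mapping.keys m \<subseteq> ?V" "val (lmon ?y m) = 0"
    \<comment> \<open>With \<open>m0\<close> the part of \<open>m\<close> away from
      \<open>k\<close>, the value of \<open>m\<close> is that of the old monomial with exponent
      \<open>m0 + frag_cmul c (e \<epsilon>)\<close>, whose coordinate at \<open>k\<close> is
      \<open>- c\<close>.\<close>
    define c where "c = Poly_Mapping.lookup m k"
    define m0 where "m0 = m - Poly_Mapping.single k c"
    have m_eq: "m = m0 + Poly_Mapping.single k c" by (simp add: m0_def)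
    have m0: "Poly_Mapping.lookup m0 k = 0" "Poly_Mapping.keys m0 \<subseteq> ?V"
      using m(1) V keys_diff[of m "Poly_Mapping.single k c"]
      by (auto simp: m0_def c_def lookup_minus split: if_splits)
    have "lmon ?y m0 = lmon ?x m0"
      using m0(1) by (intro lmon_cong) (auto simp: in_keys_iff)
    then have y: "lmon ?y m = lmon ?x m0 * mutate_var s k powi c"
      using nz sum(1) by (subst m_eq) (simp add: lmon_add lmon_single)
    have "0 = val (lmon ?x m0) + val (mutate_var s k powi c)"
      using m(2) y nz sum(1) inR m0 by (simp add: val_mult independent_in[OF ind] lmon_nz power_int_in)
    also have "val (mutate_var s k powi c) = val (lmon ?x (frag_cmul c (e \<epsilon>)))"
      unfolding lmon_cmul
      by (intro val_power_int_cong inR sum \<epsilon> independent_in[OF ind] e lmon_nz nz)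
    finally have "val (lmon ?x (m0 + frag_cmul c (e \<epsilon>))) = 0"
      using e keys_cmul[of c "e \<epsilon>"] m0 nz
      by (simp add: lmon_add val_mult independent_in[OF ind] lmon_nz order_trans)
    moreover have "Poly_Mapping.keys (m0 + frag_cmul c (e \<epsilon>)) \<subseteq> ?V"
      using keys_add[of m0 "frag_cmul c (e \<epsilon>)"] e(1)[of \<epsilon>] keys_cmul[of c "e \<epsilon>"] m0 by blast
    ultimately have zero: "m0 + frag_cmul c (e \<epsilon>) = 0"
      using ind by (auto simp: independent_def)
    from arg_cong[OF this, of "\<lambda>m. Poly_Mapping.lookup m k"] have "c = 0"
      by (simp add: lookup_add m0 e)
    then show "m = 0" using zero m_eq by simp
  qed
qed

lemma admissible_mutate:
  assumes "admissible s" "k \<in> mutable s"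
  shows "admissible (mutate k s)"
  using assms mutate_var_nz_independent[OF assms] skew_full_rank_mutate by (auto simp: admissible_def)

lemma mutate_involutive:
  assumes "admissible s" "k \<in> mutable s"
  shows "mutate k (mutate k s) = s"
  using assms mutate_var_nz_independent(1)[OF assms] skew_full_rankD(2)
  by (intro mutate_mutate) (auto simp: admissible_def)

end

section \<open>The Laurent phenomenon\<close>

text \<open>Multiplication by \<open>q\<close> is injective modulo \<open>z\<close>. This is the
  form in which a denominator \<open>z\<close> is cancelled against a denominator
  \<open>q\<close>.\<close>

definition coprime_in :: "'k::comm_ring_1 set \<Rightarrow> 'k \<Rightarrow> 'k \<Rightarrow> bool" where
  "coprime_in A z q \<longleftrightarrow> (\<forall>h\<in>A. \<forall>g\<in>A. q * h = z * g \<longrightarrow> (\<exists>k\<in>A. h = z * k))"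

lemma coprime_inD:
  "coprime_in A z q \<Longrightarrow> h \<in> A \<Longrightarrow> g \<in> A \<Longrightarrow> q * h = z * g \<Longrightarrow> \<exists>k\<in>A. h = z * k"
  by (auto simp: coprime_in_def)

context
  fixes A :: "'k::field set"
  assumes A: "is_subring A"
begin

definition unit_in :: "'k \<Rightarrow> bool" where
  "unit_in a \<longleftrightarrow> a \<in> A \<and> a \<noteq> 0 \<and> inverse a \<in> A"

lemma unit_in_mult: "unit_in a \<Longrightarrow> unit_in b \<Longrightarrow> unit_in (a * b)"
  by (auto simp: unit_in_def subring_mult[OF A])

lemma unit_in_inverse: "unit_in a \<Longrightarrow> unit_in (inverse a)"
  by (auto simp: unit_in_def)

lemma unit_in_divide: "unit_in a \<Longrightarrow> unit_in b \<Longrightarrow> unit_in (a / b)"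
  by (simp add: divide_inverse unit_in_mult unit_in_inverse)

lemma unit_in_power: "unit_in a \<Longrightarrow> unit_in (a ^ n)"
  by (auto simp: unit_in_def subring_power[OF A] simp flip: power_inverse)

lemma unit_in_prod: "(\<And>i. i \<in> I \<Longrightarrow> unit_in (f i)) \<Longrightarrow> unit_in (prod f I)"
  by (induction I rule: infinite_finite_induct)
    (auto intro: unit_in_mult simp: subring_one[OF A] unit_in_def[of 1])

lemma coprime_in_unit:
  assumes "unit_in a"
  shows "coprime_in A z a"
proof -
  have "\<exists>k\<in>A. h = z * k" if "g \<in> A" "a * h = z * g" for h g
  proof (intro bexI[of _ "inverse a * g"])
    have "h = inverse a * (a * h)" using assms by (simp add: unit_in_def)
    then show "h = z * (inverse a * g)" unfolding that(2) by (simp add: mult_ac)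
    show "inverse a * g \<in> A" using that(1) assms by (simp add: unit_in_def subring_mult[OF A])
  qed
  then show ?thesis by (auto simp: coprime_in_def)
qed

lemma coprime_in_mult:
  assumes "q \<in> A" "coprime_in A z p" "coprime_in A z q"
  shows "coprime_in A z (p * q)"
  unfolding coprime_in_def
proof (intro ballI impI)
  fix h g assume h: "h \<in> A" "g \<in> A" "p * q * h = z * g"
  then have "p * (q * h) = z * g" by (simp add: mult.assoc)
  then obtain k where "k \<in> A" "q * h = z * k"
    using coprime_inD[OF assms(2)] subring_mult[OF A assms(1) h(1)] h(2) by blast
  then show "\<exists>k\<in>A. h = z * k" using coprime_inD[OF assms(3)] h(1) by blast
qed

lemma coprime_in_power:
  assumes "q \<in> A" "coprime_in A z q"
  shows "coprime_in A z (q ^ n)"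
proof (induction n)
  case 0
  then show ?case by (auto simp: coprime_in_def)
next
  case (Suc n)
  then show ?case using coprime_in_mult[of "q ^ n" z q] assms subring_power[OF A] by simp
qed

text \<open>Factors \<open>z\<close> are removed one at a time: \<open>z\<close> divides
  \<open>q ^ b * (z ^ Suc a * f)\<close>, hence also \<open>z ^ Suc a * f\<close>.\<close>

lemma coprime_denominators:
  assumes "z \<in> A" "z \<noteq> 0" "q \<in> A" "coprime_in A z q" "z ^ a * f \<in> A" "q ^ b * f \<in> A"
  shows "f \<in> A"
  using assms(5)
proof (induction a)
  case (Suc a)
  have "q ^ b * (z ^ Suc a * f) = z * (z ^ a * (q ^ b * f))" by (simp add: mult_ac)
  then obtain k where k: "k \<in> A" "z ^ Suc a * f = z * k"
    using coprime_inD[OF coprime_in_power[OF assms(3,4)] Suc.prems]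
      subring_mult[OF A subring_power[OF A assms(1)] assms(6)] by blast
  then have "z ^ a * f = k" using assms(2) by (simp add: mult.assoc)
  then show ?case using Suc.IH k(1) by simp
qed simp

lemma coprime_in_mod_unit:
  assumes "unit_in a" "t \<in> A"
  shows "coprime_in A z (a + z * t)"
proof -
  have "\<exists>k\<in>A. h = z * k" if h: "h \<in> A" "g \<in> A" "(a + z * t) * h = z * g" for h g
  proof -
    have "a * h = z * (g - t * h)" using h(3) by (simp add: algebra_simps)
    then show ?thesis
      using coprime_inD[OF coprime_in_unit[OF assms(1)] h(1)] h assms(2)
        subring_diff[OF A] subring_mult[OF A] by blast
  qed
  then show ?thesis by (auto simp: coprime_in_def)
qed

lemma power_diff_factor:
  assumes "p \<in> A" "q \<in> A"
  shows "\<exists>t\<in>A. p ^ n - q ^ n = (p - q) * t"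
proof (induction n)
  case 0
  then show ?case using subring_zero[OF A] by force
next
  case (Suc n)
  then obtain t where t: "t \<in> A" "p ^ n - q ^ n = (p - q) * t" by blast
  have "p ^ Suc n - q ^ Suc n = p * (p ^ n - q ^ n) + (p - q) * q ^ n"
    by (simp add: algebra_simps)
  also have "\<dots> = (p - q) * (p * t + q ^ n)"
    unfolding t(2) by (simp add: algebra_simps)
  finally show ?case
    using t(1) assms by (blast intro: subring_add[OF A] subring_mult[OF A] subring_power[OF A])
qed

text \<open>Three consecutive exchanges at \<open>i\<close>, \<open>j\<close>, \<open>i\<close> with \<open>b\<close> arrows from \<open>i\<close> to \<open>j\<close>: here \<open>x\<close>, \<open>y\<close> are the
  variables at \<open>i\<close>, \<open>j\<close>, and \<open>z\<close>, \<open>u\<close>, \<open>v\<close> the successive new ones. The relation between the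
  coefficients makes \<open>C + (A / y) ^ b * D\<close> a unit multiple of \<open>x * z\<close>.\<close>

lemma three_exchanges:
  assumes units: "unit_in x" "unit_in y" "unit_in A'" "unit_in B" "unit_in C" "unit_in D" "unit_in C0" "unit_in D0"
    and z: "z = (C0 + y ^ b * D0) / x" "z \<noteq> 0"
    and u: "u = (A' + z ^ b * B) / y"
    and v: "v = (C + u ^ b * D) / z"
    and b: "b > 0"
    and rel: "C * C0 = D * D0 * A' ^ b"
  shows "z \<in> A" "u \<in> A" "v \<in> A" "coprime_in A z u"
    "b \<noteq> 1 \<Longrightarrow> coprime_in A z v" "b = 1 \<Longrightarrow> v = D * B / y * (1 + A' * x / (C0 * B))"
proof -
  note closed = subring_mult[OF A] subring_add[OF A] subring_power[OF A]
  have nz: "x \<noteq> 0" "y \<noteq> 0" "A' \<noteq> 0" "B \<noteq> 0" "C \<noteq> 0" "D \<noteq> 0" "C0 \<noteq> 0" "D0 \<noteq> 0"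
    using units by (auto simp: unit_in_def)
  have inA: "a \<in> A" if "unit_in a" for a using that by (simp add: unit_in_def)
  show zA: "z \<in> A" unfolding z(1) divide_inverse
    using units by (intro closed) (auto simp: unit_in_def)
  define a where "a = A' / y"
  define B' where "B' = B / y"
  define \<beta> where "\<beta> = D * A' ^ b / (C0 * y ^ b)"
  have ua: "unit_in a" "unit_in B'" "unit_in \<beta>"
    unfolding a_def B'_def \<beta>_def by (intro unit_in_divide unit_in_mult unit_in_power units)+
  note inAs = zA ua[THEN inA] units[THEN inA]
  have u_eq: "u = a + z * (z ^ (b - 1) * B')"
    using b by (simp add: u a_def B'_def add_divide_distrib power_eq_if mult_ac)
  show uA: "u \<in> A" unfolding u_eq by (intro closed inAs)
  show "coprime_in A z u" unfolding u_eq
    by (intro coprime_in_mod_unit ua closed inAs)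
  obtain t where t: "t \<in> A" "u ^ b - a ^ b = (u - a) * t"
    using power_diff_factor[OF uA inA[OF ua(1)]] by blast
  define T where "T = z ^ (b - 1) * B' * t"
  have T: "u ^ b = a ^ b + z * T"
    using t(2) u_eq by (simp add: T_def algebra_simps)
  have TA: "T \<in> A" unfolding T_def by (intro closed inAs t(1))
  have "\<beta> * x * z = C + a ^ b * D"
  proof -
    have "\<beta> * x * z = D * A' ^ b / (C0 * y ^ b) * (C0 + y ^ b * D0)"
      using nz by (simp add: \<beta>_def z)
    also have "\<dots> = a ^ b * D + D * D0 * A' ^ b / C0"
      using nz by (simp add: a_def power_divide field_simps)
    also have "\<dots> = a ^ b * D + C"
      using nz by (simp flip: rel)
    finally show ?thesis by simp
  qed
  moreover have "v * z = C + (a ^ b + z * T) * D"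
    unfolding T[symmetric] using z(2) by (simp add: v)
  ultimately have "v * z = (\<beta> * x + D * T) * z"
    by (simp add: algebra_simps)
  then have v_eq: "v = \<beta> * x + D * T" using z(2) by simp
  show "v \<in> A" unfolding v_eq by (intro closed inAs TA)
  show "coprime_in A z v" if "b \<noteq> 1"
  proof -
    \<comment> \<open>For \<open>b\<close> at least 2 a factor \<open>z\<close> is left in
      \<open>z ^ (b - 1)\<close>, so modulo \<open>z\<close> the element \<open>v\<close> is the
      unit \<open>\<beta> * x\<close>.\<close>
    have "T = z * (z ^ (b - 2) * B' * t)"
    proof -
      have "b = Suc (Suc (b - 2))" using b that by simp
      then obtain c where "b = Suc (Suc c)" by blast
      then show ?thesis by (simp add: T_def)
    qed
    then have "v = \<beta> * x + z * (D * (z ^ (b - 2) * B' * t))"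
      unfolding v_eq by (simp add: mult_ac)
    then show ?thesis
      by (simp only:) (intro coprime_in_mod_unit unit_in_mult ua units closed inAs t(1))
  qed
  \<comment> \<open>With a single arrow no factor \<open>z\<close> is left. Here \<open>v\<close> is
    a binomial up to a unit, and its coprimality to \<open>z\<close> will come from a
    grading.\<close>
  show "v = D * B / y * (1 + A' * x / (C0 * B))" if "b = 1"
  proof -
    have "u - a = z * B'" using u_eq that by simp
    then have "T = B'"
      using T that z(2) by (simp add: algebra_simps)
    then show ?thesis
      unfolding v_eq using that nz by (simp add: \<beta>_def B'_def field_simps)
  qed
qed

end

lemma fold_mutate_simps:
  "mutable (fold mutate ks s) = mutable s" "vertices (fold mutate ks s) = vertices s"
  by (induction ks arbitrary: s) auto

text \<open>As \<open>nat\<close> cuts off negative values, \<open>f\<close> and its negative give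
  the two monomials that a column \<open>f\<close> contributes to an exchange relation.\<close>

definition cpow :: "('v \<Rightarrow> 'k::field) \<Rightarrow> 'v set \<Rightarrow> ('v \<Rightarrow> int) \<Rightarrow> 'k" where
  "cpow x A f = (\<Prod>a\<in>A. x a ^ nat (f a))"

lemma cpow_lmon: "finite A \<Longrightarrow> cpow x A f = lmon x (exponent A (\<lambda>a. int (nat (f a))))"
  by (simp only: cpow_def lmon_exponent power_int_of_nat)

lemma cpow_cong: "(\<And>a. a \<in> A \<Longrightarrow> f a = g a) \<Longrightarrow> cpow x A f = cpow x A g"
  by (auto simp: cpow_def intro!: prod.cong)

context seed_valuation
begin

section \<open>Descent along three mutations at \<open>i\<close>, \<open>j\<close>,
  \<open>i\<close>\<close>

context
  fixes s :: "'v seed" and i j :: 'v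
  assumes s: "admissible s" and ij: "i \<in> mutable s" "j \<in> mutable s" "i \<noteq> j"
begin

private abbreviation (input) "W0 \<equiv> vertices s - {i, j}"
private abbreviation (input) "L \<equiv> laurent_ring (cvar s) (vertices s)"

private abbreviation (input) "mono_W f \<equiv> cpow (cvar s) W0 f"
private abbreviation (input) "pow_exp f \<equiv> exponent W0 (\<lambda>a. int (nat (f a)))"

private lemma full_rank: "skew_full_rank s"
  using s by (simp add: admissible_def)

private lemma fin: "finite (vertices s)"
  using skew_full_rankD(1)[OF full_rank] .

private lemma ind: "independent (cvar s) (vertices s)"
  using s by (simp add: admissible_def)

private lemma nz: "cvar s a \<noteq> 0"
  using independent_nz[OF ind] .

private lemma ijV: "i \<in> vertices s" "j \<in> vertices s"
  using ij by (auto simp: vertices_def)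

private lemma L: "is_subring L"
  using laurent_ring_subring[of "cvar s" "vertices s"] nz by blast

private lemma unit_lmon: "Poly_Mapping.keys m \<subseteq> vertices s \<Longrightarrow> unit_in L (lmon (cvar s) m)"
  using lmon_in_laurent_ring[of m "vertices s" "cvar s"] lmon_in_laurent_ring[of "- m" "vertices s" "cvar s"]
    lmon_diff[of "cvar s" 0 m] lmon_nz[of "cvar s" m] nz
  by (auto simp: unit_in_def[OF L] divide_inverse)

private lemma unit_cvar: "a \<in> vertices s \<Longrightarrow> unit_in L (cvar s a)"
  using unit_lmon[of "Poly_Mapping.single a 1"] by simp

private lemma mon_lmon: "mono_W f = lmon (cvar s) (pow_exp f)"
  using fin by (simp add: cpow_lmon)

private lemma keys_pow_exp: "Poly_Mapping.keys (exponent W0 f) \<subseteq> W0"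
  using fin keys_exponent by blast

private lemma unit_mon: "unit_in L (mono_W f)"
  unfolding mon_lmon using keys_pow_exp by (intro unit_lmon) blast

private lemma prod_split:
  assumes "\<And>a. a \<in> W0 \<Longrightarrow> y a = cvar s a"
  shows "(\<Prod>a\<in>vertices s. y a ^ nat (f a)) = mono_W f * y i ^ nat (f i) * y j ^ nat (f j)"
proof -
  have V: "vertices s = insert i (insert j W0)" using ijV by blast
  have "(\<Prod>a\<in>W0. y a ^ nat (f a)) = mono_W f"
    unfolding cpow_def using assms by (intro prod.cong) auto
  then show ?thesis
    using fin ij by (subst V) (simp add: mult_ac)
qed

text \<open>Among the variables \<open>X1\<close> only \<open>z\<close> can fail to be a unit of
  \<open>L\<close>, and among \<open>X3\<close> only \<open>u\<close> and \<open>v\<close>. So a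
  power of \<open>z\<close> clears the denominators of \<open>f\<close>, and so does a power of
  \<open>v * u\<close>; coprimality then leaves no denominator.\<close>

private lemma laurent_descent_aux:
  fixes z u v :: ratfun
  assumes z: "z \<in> L" "z \<noteq> 0" and uv: "u \<in> L" "v \<in> L" "coprime_in L z u" "coprime_in L z v"
    and X1: "\<And>a. a \<in> vertices s - {i} \<Longrightarrow> X1 a = cvar s a" "X1 i = z" "\<And>a. X1 a \<noteq> 0"
    and X3: "\<And>a. a \<in> W0 \<Longrightarrow> X3 a = cvar s a" "X3 i = v" "X3 j = u" "\<And>a. X3 a \<noteq> 0"
    and f: "f \<in> laurent_ring X1 (vertices s)" "f \<in> laurent_ring X3 (vertices s)"
  shows "f \<in> L"
proof -
  have inL: "unit_in L a \<Longrightarrow> a \<in> L" for a by (simp add: unit_in_def[OF L])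
  have X1L: "X1 a \<in> L" if "a \<in> vertices s" for a
    using that z X1 inL[OF unit_cvar] by (cases "a = i") auto
  have X3L: "X3 a \<in> L" if "a \<in> vertices s" for a
    using that uv X3 inL[OF unit_cvar] by (cases "a = i"; cases "a = j") auto
  obtain N where N: "(\<Prod>a\<in>vertices s. X1 a) ^ N * f \<in> L"
    using laurent_ring_denominator[OF X1(3) fin f(1) L X1L] by blast
  obtain M where M: "(\<Prod>a\<in>vertices s. X3 a) ^ M * f \<in> L"
    using laurent_ring_denominator[OF X3(4) fin f(2) L X3L] by blast
  define U where "U = (\<Prod>a\<in>vertices s - {i}. cvar s a)"
  define U' where "U' = (\<Prod>a\<in>W0. cvar s a)"
  have U: "unit_in L U" "unit_in L U'"
    unfolding U_def U'_def by (intro unit_in_prod[OF L] unit_cvar; simp)+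
  have P1: "(\<Prod>a\<in>vertices s. X1 a) = z * U"
    using prod.remove[OF fin ijV(1), of X1] X1 by (simp add: U_def)
  have V: "vertices s = insert i (insert j W0)" using ijV by blast
  have P3: "(\<Prod>a\<in>vertices s. X3 a) = v * u * U'"
    using fin ij X3 by (subst V) (simp add: U'_def mult_ac)
  have "inverse U ^ N * ((z * U) ^ N * f) \<in> L"
    using subring_mult[OF L subring_power[OF L]] N U unfolding P1 unit_in_def[OF L] by blast
  moreover have "inverse U ^ N * ((z * U) ^ N * f) = z ^ N * f"
    using U(1) by (simp add: unit_in_def[OF L] power_mult_distrib field_simps)
  ultimately have zN: "z ^ N * f \<in> L" by simp
  have "coprime_in L z (v * u * U')"
    by (intro coprime_in_mult[OF L] coprime_in_unit[OF L] uv U inL[OF U(2)])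
  moreover have "v * u * U' \<in> L"
    by (intro subring_mult[OF L] uv inL[OF U(2)])
  ultimately show ?thesis
    using coprime_denominators[OF L z _ _ zN] M unfolding P3 by blast
qed

private abbreviation (input) "s1 \<equiv> mutate i s"
private abbreviation (input) "s2 \<equiv> mutate j s1"
private abbreviation (input) "s3 \<equiv> mutate i s2"

private lemma admissible_123: "admissible s1" "admissible s2" "admissible s3"
  using s ij by (auto intro!: admissible_mutate)

private lemma skew: "mult s a b = - mult s b a" "mult s1 a b = - mult s1 b a" "mult s2 a b = - mult s2 b a"
  by (rule skew_full_rankD(2), use s admissible_123 in \<open>simp add: admissible_def\<close>)+

private lemma mult_1:
  "mult s1 i j = - mult s i j" "mult s1 j i = - mult s j i" "mult s1 a i = - mult s a i" "mult s1 j j = 0"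
  using mutate_mult_incident[OF skew(1)] mult_self[of s1 j, OF skew(2)] by auto

private lemma mult_2:
  "mult s2 i i = 0" "mult s2 j i = mult s j i"
  "a \<in> W0 \<Longrightarrow> mult s2 a i = - mult s a i
    + max 0 (mult s1 a j) * max 0 (mult s i j) - max 0 (- mult s1 a j) * max 0 (- mult s i j)"
proof -
  show "mult s2 i i = 0" by (rule mult_self[OF skew(3)])
  show "mult s2 j i = mult s j i"
    using mutate_mult_incident(2)[of s1 j i, OF skew(2)] mult_1 by simp
  assume a: "a \<in> W0"
  have "mult s1 j i = mult s i j" using mult_1(2) skew(1)[of i j] by simp
  then show "mult s2 a i = - mult s a i
    + max 0 (mult s1 a j) * max 0 (mult s i j) - max 0 (- mult s1 a j) * max 0 (- mult s i j)"
    using a ij ijV mutate_mult_other[of s1 a i j, OF skew(2)] by (simp add: mult_1(3) mutate_mult_incident[OF skew(1)])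
qed

private lemma lookup_pow_exp: "Poly_Mapping.lookup (exponent W0 f) i = 0" "Poly_Mapping.lookup (exponent W0 f) j = 0"
  using fin by (simp_all add: lookup_exponent)

text \<open>Unit factors are allowed because exchange relations yield binomials only up to a
  monomial.\<close>

private lemma coprime_binomials:
  assumes l: "\<And>m n. l (m + n) = l m + l n" "l a = (0::int)" "l c \<noteq> 0"
    and keys: "Poly_Mapping.keys a \<subseteq> vertices s" "Poly_Mapping.keys c \<subseteq> vertices s"
    and units: "unit_in L g" "unit_in L g'"
  shows "coprime_in L (g * (1 + lmon (cvar s) a)) (g' * (1 + lmon (cvar s) c))"
  unfolding coprime_in_def
proof (intro ballI impI)
  fix h k assume hk: "h \<in> L" "k \<in> L"
    "g' * (1 + lmon (cvar s) c) * h = g * (1 + lmon (cvar s) a) * k"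
  have "(1 + lmon (cvar s) c) * h = inverse g' * (g' * (1 + lmon (cvar s) c) * h)"
    using units by (simp add: unit_in_def[OF L])
  also have "\<dots> = (1 + lmon (cvar s) a) * (inverse g' * (g * k))"
    unfolding hk(3) by (simp add: mult_ac)
  finally have eq: "(1 + lmon (cvar s) c) * h = (1 + lmon (cvar s) a) * (inverse g' * (g * k))" .
  have "inverse g' * (g * k) \<in> L"
    using units hk by (auto simp: unit_in_def[OF L] intro!: subring_mult[OF L])
  from binomial_coprime[OF ind l keys hk(1) this eq]
  obtain r where "r \<in> L" "h = (1 + lmon (cvar s) a) * r" by blast
  then show "\<exists>r\<in>L. h = g * (1 + lmon (cvar s) a) * r"
    using units by (intro bexI[of _ "inverse g * r"])
      (auto simp: unit_in_def[OF L] intro!: subring_mult[OF L])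
qed

private lemma exchange_z: "mutate_var s i = (mono_W (\<lambda>a. mult s a i) * cvar s j ^ nat (mult s j i)
    + mono_W (\<lambda>a. - mult s a i) * cvar s j ^ nat (- mult s j i)) / cvar s i"
  unfolding mutate_var_eq[of s, OF skew(1) fin]
    prod_split[of "cvar s" "\<lambda>a. mult s a i", OF refl] prod_split[of "cvar s" "\<lambda>a. - mult s a i", OF refl]
  by (simp add: mult_self[of s, OF skew(1)])

private lemma cvar_1: "a \<in> W0 \<Longrightarrow> cvar s1 a = cvar s a" "cvar s1 i = mutate_var s i" "cvar s1 j = cvar s j"
  using ij by auto

private lemma cvar_2: "a \<in> W0 \<Longrightarrow> cvar s2 a = cvar s a" "cvar s2 i = mutate_var s i" "cvar s2 j = mutate_var s1 j"
  using ij by auto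

private lemma exchange_u: "mutate_var s1 j = (mono_W (\<lambda>a. mult s1 a j) * mutate_var s i ^ nat (- mult s i j)
    + mono_W (\<lambda>a. - mult s1 a j) * mutate_var s i ^ nat (mult s i j)) / cvar s j"
  using mutate_var_eq[of s1 j, OF skew(2)] fin ij
    prod_split[of "cvar s1" "\<lambda>a. mult s1 a j", OF cvar_1(1)] prod_split[of "cvar s1" "\<lambda>a. - mult s1 a j", OF cvar_1(1)]
    mult_1 by (simp only: mutate_simps(3) cvar_1) simp

private lemma exchange_v: "mutate_var s2 i = (mono_W (\<lambda>a. mult s2 a i) * mutate_var s1 j ^ nat (mult s j i)
    + mono_W (\<lambda>a. - mult s2 a i) * mutate_var s1 j ^ nat (- mult s j i)) / mutate_var s i"
  using mutate_var_eq[of s2 i, OF skew(3)] fin ij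
    prod_split[of "cvar s2" "\<lambda>a. mult s2 a i", OF cvar_2(1)] prod_split[of "cvar s2" "\<lambda>a. - mult s2 a i", OF cvar_2(1)]
    mult_2 by (simp only: mutate_simps(3) cvar_2) simp

private lemma mutate_var_nz: "mutate_var s i \<noteq> 0"
  using mutate_var_nz_independent(1)[OF s ij(1)] .

private lemma laurent_descent_coprime:
  assumes "mutate_var s i \<in> L" "mutate_var s1 j \<in> L" "mutate_var s2 i \<in> L"
    "coprime_in L (mutate_var s i) (mutate_var s1 j)" "coprime_in L (mutate_var s i) (mutate_var s2 i)"
    and "f \<in> laurent_ring (cvar s1) (vertices s)" "f \<in> laurent_ring (cvar s3) (vertices s)"
  shows "f \<in> L"
proof (rule laurent_descent_aux[OF assms(1) mutate_var_nz assms(2-5) _ _ _ _ _ _ _ assms(6,7)])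
  show "cvar s1 a \<noteq> 0" "cvar s3 a \<noteq> 0" for a
    using independent_nz[of "cvar s1"] independent_nz[of "cvar s3"] admissible_123
    unfolding admissible_def by blast+
qed (use ij in auto)

lemma laurent_descent_pos:
  assumes pos: "mult s i j > 0"
    and f: "f \<in> laurent_ring (cvar s1) (vertices s)" "f \<in> laurent_ring (cvar s3) (vertices s)"
  shows "f \<in> L"
proof -
  define b where "b = nat (mult s i j)"
  have b: "mult s i j = int b" "mult s j i = - int b" "b > 0"
    using pos skew(1)[of j i] by (auto simp: b_def)
  let ?K = "mono_W (\<lambda>a. mult s a i)" and ?E = "mono_W (\<lambda>a. - mult s a i)"
  let ?A = "mono_W (\<lambda>a. mult s1 a j)" and ?B = "mono_W (\<lambda>a. - mult s1 a j)"
  let ?C = "mono_W (\<lambda>a. mult s2 a i)" and ?D = "mono_W (\<lambda>a. - mult s2 a i)"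
  have z: "mutate_var s i = (?K + cvar s j ^ b * ?E) / cvar s i"
    using exchange_z b by (simp add: mult.commute)
  have u: "mutate_var s1 j = (?A + mutate_var s i ^ b * ?B) / cvar s j"
    using exchange_u b by (simp add: mult.commute)
  have v: "mutate_var s2 i = (?C + mutate_var s1 j ^ b * ?D) / mutate_var s i"
    using exchange_v b by (simp add: mult.commute)
  \<comment> \<open>An integer is its positive part minus its negative part. So at each vertex this
    is the mutation rule for the column at \<open>i\<close>, whose correction is \<open>b\<close>
    times the positive part of the column at \<open>j\<close> in \<open>s1\<close>.\<close>
  have rel: "?C * ?K = ?D * ?E * ?A ^ b"
    unfolding cpow_def prod_power_distrib prod.distrib[symmetric]
  proof (intro prod.cong refl)
    fix a assume "a \<in> W0"
    then have "mult s2 a i = - mult s a i + max 0 (mult s1 a j) * int b"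
      using mult_2(3)[of a] b by simp
    moreover have "nat (mult s1 a j) * b = nat (max 0 (mult s1 a j) * int b)"
      by (simp add: nat_mult_distrib max_def)
    moreover have "0 \<le> max 0 (mult s1 a j) * int b" by simp
    ultimately have "nat (mult s2 a i) + nat (mult s a i) = nat (- mult s2 a i) + nat (- mult s a i) + nat (mult s1 a j) * b"
      by linarith
    then show "cvar s a ^ nat (mult s2 a i) * cvar s a ^ nat (mult s a i)
      = cvar s a ^ nat (- mult s2 a i) * cvar s a ^ nat (- mult s a i) * (cvar s a ^ nat (mult s1 a j)) ^ b"
      by (simp only: power_add[symmetric] power_mult[symmetric])
  qed
  note ex = three_exchanges[OF L unit_cvar[OF ijV(1)] unit_cvar[OF ijV(2)] unit_mon unit_mon unit_mon unit_mon
      unit_mon unit_mon z mutate_var_nz u v b(3) rel]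
  have "coprime_in L (mutate_var s i) (mutate_var s2 i)"
  proof (cases "b = 1")
    case True
    \<comment> \<open>\<open>a\<close> and \<open>c\<close> are the exponents of the binomials left
      of \<open>z\<close> and \<open>v\<close> after unit factors are taken out. The grading by the
      exponent at \<open>i\<close> is 0 on \<open>a\<close> and 1 on \<open>c\<close>.\<close>
    define a where "a = Poly_Mapping.single j 1 + pow_exp (\<lambda>a. - mult s a i) - pow_exp (\<lambda>a. mult s a i)"
    define c where "c = pow_exp (\<lambda>a. mult s1 a j) + Poly_Mapping.single i 1
      - (pow_exp (\<lambda>a. mult s a i) + pow_exp (\<lambda>a. - mult s1 a j))"
    have lmon_a: "lmon (cvar s) a = cvar s j * ?E / ?K"
      and lmon_c: "lmon (cvar s) c = ?A * cvar s i / (?K * ?B)"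
      by (simp_all only: a_def c_def lmon_add[OF nz] lmon_diff[OF nz] lmon_single_1 mon_lmon)
    have keys: "Poly_Mapping.keys a \<subseteq> vertices s" "Poly_Mapping.keys c \<subseteq> vertices s"
      using keys_pow_exp fin ijV by (auto simp: a_def c_def in_keys_iff lookup_add lookup_minus lookup_exponent
          lookup_single when_def split: if_splits)
    have z': "mutate_var s i = ?K / cvar s i * (1 + lmon (cvar s) a)"
    proof -
      have "?K \<noteq> 0" using unit_mon by (simp add: unit_in_def[OF L])
      then have "?K * (1 + cvar s j * ?E / ?K) = ?K + cvar s j * ?E"
        by (simp add: distrib_left)
      then show ?thesis unfolding lmon_a z using True by simp
    qed
    have v': "mutate_var s2 i = ?D * ?B / cvar s j * (1 + lmon (cvar s) c)"
      unfolding lmon_c using ex(6) True by blast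
    show ?thesis
      unfolding z' v' using ij
      by (intro coprime_binomials[where l = "\<lambda>m. Poly_Mapping.lookup m i"] keys unit_in_divide[OF L]
          unit_in_mult[OF L] unit_mon unit_cvar ijV)
        (auto simp: a_def c_def lookup_add lookup_minus lookup_pow_exp lookup_single)
  qed (use ex(5) in blast)
  then show ?thesis
    using laurent_descent_coprime[OF ex(1-4) _ f] by blast
qed

text \<open>Without arrows between \<open>i\<close> and \<open>j\<close> the mutations there do not
  interact: the third one restores the variable at \<open>i\<close>, a unit of \<open>L\<close>, and
  \<open>z\<close> and \<open>u\<close> are binomials given by the columns at \<open>i\<close> and
  \<open>j\<close>. Independence of these columns provides a grading that separates them.\<close>

lemma laurent_descent_zero:
  assumes zero: "mult s i j = 0"
    and f: "f \<in> laurent_ring (cvar s1) (vertices s)" "f \<in> laurent_ring (cvar s3) (vertices s)"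
  shows "f \<in> L"
proof -
  have zero': "mult s j i = 0" using zero skew(1)[of j i] by simp
  let ?ci = "exponent W0 (\<lambda>a. mult s a i)" and ?cj = "exponent W0 (\<lambda>a. mult s a j)"
  have binom: "mono_W f + mono_W (\<lambda>a. - f a) = mono_W (\<lambda>a. - f a) * (1 + lmon (cvar s) (exponent W0 f))" for f
  proof -
    have "pow_exp f = pow_exp (\<lambda>a. - f a) + exponent W0 f"
      using fin by (intro poly_mapping_eqI) (simp add: lookup_exponent lookup_add)
    then have "mono_W f = mono_W (\<lambda>a. - f a) * lmon (cvar s) (exponent W0 f)"
      by (simp only: mon_lmon lmon_add[OF nz])
    then show ?thesis by (simp add: algebra_simps)
  qed
  have col_j: "mult s1 a j = mult s a j" if "a \<in> W0" for a
    using that ij ijV mutate_mult_other[of s a j i, OF skew(1)] zero by simp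
  have "mutate_var s i = mono_W (\<lambda>a. - mult s a i) * (1 + lmon (cvar s) ?ci) / cvar s i"
    using exchange_z zero' binom by simp
  then have z: "mutate_var s i = mono_W (\<lambda>a. - mult s a i) / cvar s i * (1 + lmon (cvar s) ?ci)"
    by simp
  have "mutate_var s1 j = (mono_W (\<lambda>a. mult s a j) + mono_W (\<lambda>a. - mult s a j)) / cvar s j"
    using exchange_u zero cpow_cong[of W0 "\<lambda>a. mult s1 a j" "\<lambda>a. mult s a j" "cvar s"]
      cpow_cong[of W0 "\<lambda>a. - mult s1 a j" "\<lambda>a. - mult s a j" "cvar s"] col_j by simp
  then have u: "mutate_var s1 j = mono_W (\<lambda>a. - mult s a j) / cvar s j * (1 + lmon (cvar s) ?cj)"
    unfolding binom by simp
  have "mutate_var s2 i = (mono_W (\<lambda>a. - mult s a i) + mono_W (\<lambda>a. mult s a i)) / mutate_var s i"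
    using exchange_v zero zero' cpow_cong[of W0 "\<lambda>a. mult s2 a i" "\<lambda>a. - mult s a i" "cvar s"]
      cpow_cong[of W0 "\<lambda>a. - mult s2 a i" "\<lambda>a. mult s a i" "cvar s"] mult_2(3) by simp
  also have "\<dots> = mutate_var s i * cvar s i / mutate_var s i"
    using exchange_z zero' nz by (simp add: add.commute)
  finally have v: "mutate_var s2 i = cvar s i"
    using mutate_var_nz by simp
  obtain p q where pq: "p \<in> vertices s" "q \<in> vertices s" "mult s p i * mult s q j \<noteq> mult s q i * mult s p j"
    using two_columns_independent[OF full_rank ij] .
  have rows: "mult s i i = 0" "mult s j j = 0" using mult_self[of s, OF skew(1)] by auto
  \<comment> \<open>Rows \<open>i\<close> and \<open>j\<close> vanish in both columns, so a nonzero
    minor cannot use them.\<close>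
  have pqW: "p \<in> W0" "q \<in> W0" using pq rows zero zero' by auto
  have keys: "Poly_Mapping.keys (exponent W0 g) \<subseteq> vertices s" for g
    using keys_pow_exp by blast
  \<comment> \<open>The grading of an exponent is the minor, in rows \<open>p\<close> and
    \<open>q\<close>, of the column at \<open>i\<close> and that exponent; it is zero on
    \<open>?ci\<close> and nonzero on \<open>?cj\<close>.\<close>
  have cop: "coprime_in L (mutate_var s i) (mutate_var s1 j)"
    unfolding z u
  proof (rule coprime_binomials[where l = "\<lambda>m. mult s p i * Poly_Mapping.lookup m q - mult s q i * Poly_Mapping.lookup m p"])
    show "unit_in L (mono_W (\<lambda>a. - mult s a i) / cvar s i)" "unit_in L (mono_W (\<lambda>a. - mult s a j) / cvar s j)"
      using unit_mon unit_cvar ijV unit_in_divide[OF L] by blast+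
  qed (use keys pqW pq(3) fin in \<open>auto simp: lookup_exponent lookup_add algebra_simps\<close>)
  have one: "1 + lmon (cvar s) (exponent W0 g) \<in> L" for g
    using keys by (intro subring_add[OF L] subring_one[OF L] lmon_in_laurent_ring)
  have uL: "unit_in L a \<Longrightarrow> a \<in> L" for a by (simp add: unit_in_def[OF L])
  have "mutate_var s i \<in> L" "mutate_var s1 j \<in> L"
    unfolding z u by (intro subring_mult[OF L] one uL unit_in_divide[OF L] unit_mon unit_cvar ijV)+
  then show ?thesis
    using laurent_descent_coprime[OF _ _ _ cop _ f] coprime_in_unit[OF L unit_cvar[OF ijV(1)]]
      uL[OF unit_cvar[OF ijV(1)]] unfolding v by blast
qed

end

lemma admissible_opposite: "admissible s \<Longrightarrow> admissible (opposite s)"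
  by (simp add: admissible_def skew_full_rank_opposite)

lemma laurent_descent:
  assumes s: "admissible s" and ij: "i \<in> mutable s" "j \<in> mutable s" "i \<noteq> j"
    and f: "f \<in> laurent_ring (cvar (mutate i s)) (vertices s)"
      "f \<in> laurent_ring (cvar (mutate i (mutate j (mutate i s)))) (vertices s)"
  shows "f \<in> laurent_ring (cvar s) (vertices s)"
proof -
  have "admissible (mutate i s)" "admissible (mutate j (mutate i s))"
    using s ij by (auto intro!: admissible_mutate)
  then have opp: "mutate i (opposite s) = opposite (mutate i s)"
    "mutate j (opposite (mutate i s)) = opposite (mutate j (mutate i s))"
    "mutate i (opposite (mutate j (mutate i s))) = opposite (mutate i (mutate j (mutate i s)))"
    using s by (auto simp: admissible_def intro!: mutate_opposite)
  have "mult s i j = - mult s j i" by (rule skew_full_rankD(2)) (use s in \<open>simp add: admissible_def\<close>)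
  then consider "mult s i j > 0" | "mult s i j = 0" | "mult (opposite s) i j > 0" by fastforce
  then show ?thesis
  proof cases
    case 1
    then show ?thesis using laurent_descent_pos[OF s ij _ f] by blast
  next
    case 2
    then show ?thesis using laurent_descent_zero[OF s ij _ f] by blast
  next
    case 3
    then show ?thesis
      using laurent_descent_pos[OF admissible_opposite[OF s], of i j f] ij f
      unfolding opp opposite_simps by blast
  qed
qed

lemma admissible_fold:
  "admissible s \<Longrightarrow> set ks \<subseteq> mutable s \<Longrightarrow> admissible (fold mutate ks s)"
  by (induction ks arbitrary: s) (auto simp: admissible_mutate)

lemma cvar_in_laurent_ring:
  assumes "v \<in> vertices s"
  shows "cvar s v \<in> laurent_ring (cvar s) (vertices s)"
  using lmon_in_laurent_ring[of "Poly_Mapping.single v 1" "vertices s" "cvar s"] assms by simp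

lemma mutate_var_in_laurent_ring:
  assumes s: "admissible s" and k: "k \<in> mutable s"
  shows "mutate_var s k \<in> laurent_ring (cvar s) (vertices s)"
proof -
  let ?L = "laurent_ring (cvar s) (vertices s)"
  have sf: "skew_full_rank s" and ind: "independent (cvar s) (vertices s)"
    using s by (auto simp: admissible_def)
  have L: "is_subring ?L"
    using laurent_ring_subring[of "cvar s" "vertices s"] independent_nz[OF ind] by blast
  have "lmon (cvar s) (Poly_Mapping.single k (- 1)) \<in> ?L"
    using k by (intro lmon_in_laurent_ring) (auto simp: vertices_def)
  then have "inverse (cvar s k) \<in> ?L" by (simp only: lmon_single power_int_minus power_int_1_right)
  then show ?thesis
    unfolding mutate_var_eq[OF skew_full_rankD(2)[OF sf] skew_full_rankD(1)[OF sf]] divide_inverse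
    using cvar_in_laurent_ring
    by (intro subring_mult[OF L] subring_add[OF L] subring_prod[OF L] subring_power[OF L])
qed

text \<open>Mutations are split off at the start of the path, so the induction has to range over all
  admissible starting seeds.\<close>

theorem laurent_phenomenon:
  assumes "admissible s" "set ks \<subseteq> mutable s" "v \<in> vertices s"
  shows "cvar (fold mutate ks s) v \<in> laurent_ring (cvar s) (vertices s)"
  using assms
proof (induction "length ks" arbitrary: ks s rule: less_induct)
  case less
  consider "ks = []" | k where "ks = [k]" | i js where "ks = i # i # js" | i j js where "ks = i # j # js" "i \<noteq> j"
    by (metis list.exhaust)
  then show ?case
  proof cases
    case 1
    then show ?thesis using cvar_in_laurent_ring less.prems by simp
  next
    case 2
    then show ?thesis
      using cvar_in_laurent_ring[of v s] mutate_var_in_laurent_ring[of s k] less.prems by simp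
  next
    case 3
    then show ?thesis
      using less.hyps[of js s] less.prems by (simp add: mutate_involutive)
  next
    case 4
    let ?f = "cvar (fold mutate ks s) v"
    let ?s1 = "mutate i s" let ?s2 = "mutate j ?s1" let ?s3 = "mutate i ?s2"
    have ij: "i \<in> mutable s" "j \<in> mutable s" and adm: "admissible ?s1" "admissible ?s2" "admissible ?s3"
      using less.prems 4 by (auto intro!: admissible_mutate)
    have "?f \<in> laurent_ring (cvar ?s1) (vertices s)"
      using less.hyps[of "j # js" ?s1] less.prems 4 adm by simp
    \<comment> \<open>Mutating \<open>?s3\<close> at \<open>i\<close> leads back to
      \<open>?s2\<close>, so from \<open>?s3\<close> the remaining path is \<open>i # js\<close>,
      which is again shorter than \<open>ks\<close>.\<close>
    moreover have "?f \<in> laurent_ring (cvar ?s3) (vertices s)"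
      using less.hyps[of "i # js" ?s3] less.prems 4 adm mutate_involutive[OF adm(2), of i] by simp
    ultimately show ?thesis
      using laurent_descent[OF less.prems(1) ij 4(2)] by blast
  qed
qed

end

section \<open>Cluster variables with equal valuation\<close>

context seed_valuation
begin

lemma fold_mutate_rev:
  assumes "admissible s" "set ks \<subseteq> mutable s"
  shows "fold mutate (rev ks) (fold mutate ks s) = s"
  using assms
proof (induction ks arbitrary: s)
  case (Cons k ks)
  then show ?case by (simp add: admissible_mutate mutate_involutive)
qed simp

text \<open>The value of \<open>f\<close> is attained at one of its exponents, and injectivity of
  the values identifies that exponent with \<open>m\<close>.\<close>

lemma lmon_exponent_of_val_eq:
  assumes ind: "independent x V" and f: "f \<in> laurent_ring x V" "f \<noteq> 0"
    and m: "Poly_Mapping.keys m \<subseteq> V" "val f = val (lmon x m)"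
  obtains p where "p \<in> supp_ring V" "f = leval x p" "m \<in> Poly_Mapping.keys p"
proof -
  obtain p where p: "p \<in> supp_ring V" "f = leval x p"
    using f(1) by (auto simp: laurent_ring_def)
  then have nz: "p \<noteq> 0" using f(2) by auto
  have "Max ((\<lambda>k. val (lmon x k)) ` Poly_Mapping.keys p) \<in> (\<lambda>k. val (lmon x k)) ` Poly_Mapping.keys p"
    using nz by (intro Max_in) auto
  then obtain k where k: "k \<in> Poly_Mapping.keys p" "val f = val (lmon x k)"
    using val_leval(3)[OF ind p(1) nz] p(2) by auto
  have "k = m"
    using k m p(1) by (intro independent_val_eq[OF ind]) (auto simp: supp_ring_def)
  then show thesis using that p k by blast
qed

end

text \<open>The two extreme valuations, taking the lexicographically largest or smallest exponent,
  already separate any two exponents, so no others are needed.\<close>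

lemma (in seed_valuation) weight_valuation_on_cluster:
  fixes t :: "'v::linorder seed" and W :: "('v \<Rightarrow>\<^sub>0 int) \<Rightarrow> ('v \<Rightarrow>\<^sub>0 int)"
  assumes t: "admissible t" and W: "W \<in> {id, uminus}"
  defines "lval \<equiv> weight_val (leval (cvar t)) (supp_ring (vertices t)) W"
    and "F \<equiv> fractions (leval (cvar t)) (supp_ring (vertices t))"
  shows "seed_valuation F lval" "seed_valuation.admissible F lval t"
    "p \<in> supp_ring (vertices t) \<Longrightarrow> p \<noteq> 0 \<Longrightarrow> lval (leval (cvar t) p) = weight W p"
proof -
  have ind: "independent (cvar t) (vertices t)" and sf: "skew_full_rank t"
    using t by (auto simp: admissible_def)
  note nz = independent_nz[OF ind]
  interpret w: weighted_ring "leval (cvar t)" "supp_ring (vertices t)" W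
  proof
    show "is_subring (supp_ring (vertices t))" by (rule supp_ring_subring)
    \<comment> \<open>The given valuation \<open>val\<close> supplies the injectivity of evaluation
      on which the new valuation is built.\<close>
    show "p = 0" if "p \<in> supp_ring (vertices t)" "leval (cvar t) p = 0" for p
      using val_leval(1)[OF ind that(1)] that(2) by blast
    show "inj W" using W by (auto simp: inj_def)
    show "W (a + b) = W a + W b" for a b using W by auto
  qed (auto simp: leval_add leval_mult nz)
  interpret l: seed_valuation F lval
    unfolding F_def lval_def by (intro seed_valuation.intro w.subfield_valuation_axioms)
  show "seed_valuation F lval" by (rule l.seed_valuation_axioms)
  show image: "lval (leval (cvar t) p) = weight W p" if "p \<in> supp_ring (vertices t)" "p \<noteq> 0" for p
    unfolding lval_def using that by (rule w.weight_val_image)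
  have mono: "lval (lmon (cvar t) m) = W m" "lmon (cvar t) m \<in> F" if "Poly_Mapping.keys m \<subseteq> vertices t" for m
    using image[OF single_in_supp_ring[OF that, of 1]] w.image_in_fractions[OF single_in_supp_ring[OF that, of 1]]
    by (simp_all add: leval_single weight_single F_def)
  have "l.independent (cvar t) (vertices t)"
    unfolding l.independent_def
  proof (intro conjI allI ballI impI)
    show "cvar t v \<in> F" if "v \<in> vertices t" for v
      using mono(2)[of "Poly_Mapping.single v 1"] that by simp
    show "m = 0" if "Poly_Mapping.keys m \<subseteq> vertices t" "lval (lmon (cvar t) m) = 0" for m
      using that mono(1)[OF that(1)] W by auto
  qed (rule nz)
  then show "l.admissible t" using sf by (simp add: l.admissible_def)
qed

theorem (in seed_valuation) cluster_variable_determined_by_val: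
  fixes t :: "'v::linorder seed"
  assumes t: "admissible t" and ks: "set ks \<subseteq> mutable t" and s: "s = fold mutate ks t"
    and vw: "v \<in> vertices t" "w \<in> vertices t" and eq: "val (cvar s w) = val (cvar t v)"
  shows "\<exists>c. cvar s w = of_int c * cvar t v"
proof -
  have adm: "admissible s" unfolding s using admissible_fold t ks .
  have V: "vertices s = vertices t" "mutable s = mutable t" by (simp_all add: s fold_mutate_simps)
  have inv: "t = fold mutate (rev ks) s" unfolding s using fold_mutate_rev t ks by metis
  have ind: "independent (cvar t) (vertices t)" "independent (cvar s) (vertices t)"
    using t adm V by (auto simp: admissible_def)
  let ?ev = "Poly_Mapping.single v (1 :: int)" and ?ew = "Poly_Mapping.single w (1 :: int)"
  have "cvar s w \<in> laurent_ring (cvar t) (vertices t)"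
    unfolding s using laurent_phenomenon t ks vw(2) .
  then obtain p where p: "p \<in> supp_ring (vertices t)" "cvar s w = leval (cvar t) p" "?ev \<in> Poly_Mapping.keys p"
    using lmon_exponent_of_val_eq[OF ind(1), of "cvar s w" ?ev] vw eq independent_nz[OF ind(2)] by auto
  have "cvar t v \<in> laurent_ring (cvar s) (vertices t)"
    using laurent_phenomenon[OF adm, of "rev ks" v] ks vw V inv by simp
  then obtain q where q: "q \<in> supp_ring (vertices t)" "cvar t v = leval (cvar s) q" "?ew \<in> Poly_Mapping.keys q"
    using lmon_exponent_of_val_eq[OF ind(2), of "cvar t v" ?ew] vw eq independent_nz[OF ind(1)] by auto
  have "k = ?ev" if k: "k \<in> Poly_Mapping.keys p" for k
  proof (rule ccontr)
    assume "k \<noteq> ?ev"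
    then obtain W :: "('v \<Rightarrow>\<^sub>0 int) \<Rightarrow> ('v \<Rightarrow>\<^sub>0 int)" where W: "W \<in> {id, uminus}" "W ?ev < W k"
      by (metis id_apply insertCI linorder_neqE neg_less_iff_less)
    let ?F = "fractions (leval (cvar t)) (supp_ring (vertices t))"
    let ?lval = "weight_val (leval (cvar t)) (supp_ring (vertices t)) W"
    note lam = weight_valuation_on_cluster[OF t W(1)]
    interpret l: seed_valuation ?F ?lval by (rule lam(1))
    \<comment> \<open>Mutation along \<open>ks\<close> carries admissibility for the new valuation
      from \<open>t\<close> to \<open>s\<close>. So there, too, the value of a Laurent polynomial in
      \<open>s\<close> is the maximum over its exponents, \<open>?ew\<close> included.\<close>
    have "l.independent (cvar s) (vertices t)"
      using l.admissible_fold[OF lam(2) ks] V unfolding s l.admissible_def by simp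
    moreover have "q \<noteq> 0" using q(3) by auto
    ultimately have "?lval (cvar t v) = Max ((\<lambda>m. ?lval (lmon (cvar s) m)) ` Poly_Mapping.keys q)"
      using l.val_leval(3)[OF _ q(1)] q(2) by simp
    then have "?lval (cvar s w) \<le> ?lval (cvar t v)"
      using q(3) by (force intro!: Max_ge)
    also have "?lval (cvar t v) = W ?ev"
      using lam(3)[OF single_in_supp_ring[of ?ev "vertices t" 1]] vw by (simp add: leval_single weight_single)
    also have "\<dots> < W k" by (rule W(2))
    also have "\<dots> \<le> weight W p" using k by (rule weight_ge)
    also have "weight W p = ?lval (cvar s w)"
    proof -
      have "p \<noteq> 0" using k by auto
      then show ?thesis unfolding p(2) by (rule lam(3)[OF p(1), symmetric])
    qed
    finally show False by simp
  qed
  then have "Poly_Mapping.keys p = {?ev}" using p(3) by blast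
  then have "cvar s w = of_int (Poly_Mapping.lookup p ?ev) * cvar t v"
    unfolding p(2) leval_def by simp
  then show ?thesis by blast
qed

section \<open>Leading monomials of flag minors\<close>

definition diagonal_monomial :: "nat set \<Rightarrow> monomial" where
  "diagonal_monomial I = (\<Sum>a<card I. Poly_Mapping.single (sorted_list_of_set I ! a, a + 1) 1)"

lemma poly_mapping_less_iff:
  "m < m' \<longleftrightarrow> (\<exists>k. Poly_Mapping.lookup m k < Poly_Mapping.lookup m' k \<and>
    (\<forall>k'<k. Poly_Mapping.lookup m k' = Poly_Mapping.lookup m' k'))"
  by (simp add: less_poly_mapping.rep_eq less_fun_def)

text \<open>All values below the first moved point \<open>a\<close> are already taken, so
  injectivity forces \<open>p a\<close> above \<open>a\<close>.\<close>

lemma permutes_first_moved: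
  assumes p: "p permutes {0..<k::nat}" "p \<noteq> id"
  obtains a where "a < k" "a < p a" "\<And>b. b < a \<Longrightarrow> p b = b"
proof -
  have ex: "\<exists>a. p a \<noteq> a" using p(2) by auto
  define a where "a = (LEAST a. p a \<noteq> a)"
  have a: "p a \<noteq> a" unfolding a_def using ex by (rule LeastI_ex)
  have fixed: "p b = b" if "b < a" for b
    using not_less_Least[of b "\<lambda>a. p a \<noteq> a"] that by (auto simp: a_def)
  have "a < k" using a permutes_not_in[OF p(1), of a] by (cases "a < k") auto
  moreover have "\<not> p a < a"
  proof
    assume "p a < a"
    then have "p (p a) = p a" by (rule fixed)
    then show False using a permutes_inj[OF p(1)] by (auto dest: injD)
  qed
  ultimately show thesis using that[of a] a fixed by auto
qed

lemma flag_minor_expansion: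
  "flag_minor I = (\<Sum>p | p permutes {0..<card I}. Poly_Mapping.single
    (\<Sum>a<card I. Poly_Mapping.single (sorted_list_of_set I ! a, p a + 1) 1) (of_int (sign p)))"
proof -
  let ?m = "\<lambda>p. \<Sum>a<card I. Poly_Mapping.single (sorted_list_of_set I ! a, p a + 1) (1::nat)"
  have prod: "(\<Prod>a<k. Var (f a)) = Poly_Mapping.single (\<Sum>a<k. Poly_Mapping.single (f a) 1) 1" for f and k :: nat
    by (induction k) (simp_all add: Var_def mult_single)
  have "signof p * (\<Prod>a = 0..<card I. mat (card I) (card I) (\<lambda>(a, b). Var (sorted_list_of_set I ! a, b + 1)) $$ (a, p a))
      = Poly_Mapping.single (?m p) (of_int (sign p))" if "p permutes {0..<card I}" for p
  proof -
    have "p a < card I" if "a < card I" for a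
      using permutes_in_image[OF \<open>p permutes {0..<card I}\<close>, of a] that by simp
    then have "(\<Prod>a = 0..<card I. mat (card I) (card I) (\<lambda>(a, b). Var (sorted_list_of_set I ! a, b + 1)) $$ (a, p a))
        = (\<Prod>a<card I. Var (sorted_list_of_set I ! a, p a + 1))"
      by (intro prod.cong) auto
    also have "\<dots> = Poly_Mapping.single (?m p) 1" by (rule prod)
    finally show ?thesis
      by (simp add: sign_def single_uminus)
  qed
  then show ?thesis
    unfolding flag_minor_def by (subst det_def'[of _ "card I"]) auto
qed

lemma flag_minor_leading:
  "Poly_Mapping.lookup (flag_minor I) (diagonal_monomial I) = 1"
  "m \<in> Poly_Mapping.keys (flag_minor I) \<Longrightarrow> m \<le> diagonal_monomial I"
proof -
  let ?r = "\<lambda>a. sorted_list_of_set I ! a" and ?P = "{p. p permutes {0..<card I}}"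
  define M where "M p = (\<Sum>a<card I. Poly_Mapping.single (?r a, p a + 1) (1::nat))" for p :: "nat \<Rightarrow> nat"
  have M_id: "M id = diagonal_monomial I" by (simp add: M_def diagonal_monomial_def)
  have r_less: "?r a < ?r b \<longleftrightarrow> a < b" "?r a = ?r b \<longleftrightarrow> a = b" if "a < card I" "b < card I" for a b
  proof -
    have mono: "?r c < ?r d" if "c < d" "d < card I" for c d
      using that sorted_wrt_nth_less[of "(<)" "sorted_list_of_set I" c d] by simp
    show "?r a < ?r b \<longleftrightarrow> a < b" "?r a = ?r b \<longleftrightarrow> a = b"
      using mono[of a b] mono[of b a] that by (metis linorder_neqE_nat order_less_asym order_less_irrefl)+
  qed
  have less: "M p < M id" if p: "p permutes {0..<card I}" "p \<noteq> id" for p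
  proof -
    obtain a where a: "a < card I" "a < p a" "\<And>b. b < a \<Longrightarrow> p b = b"
      using permutes_first_moved[OF p] by metis
    \<comment> \<open>At the first moved row \<open>a\<close> the diagonal entry occurs in
      \<open>M id\<close> but not in \<open>M p\<close>, whose entry in this row lies further right.
      All larger variables have equal exponents, because earlier rows agree and later rows give
      smaller variables.\<close>
    show ?thesis
      unfolding poly_mapping_less_iff
    proof (intro exI[of _ "(?r a, a + 1)"] conjI allI impI)
      have "Poly_Mapping.lookup (M p) (?r a, a + 1) = 0"
        using a r_less by (auto simp: M_def lookup_sum lookup_single when_def)
      moreover have "Poly_Mapping.lookup (M id) (?r a, a + 1) = (\<Sum>b<card I. if b = a then 1 else 0)"
        unfolding M_def lookup_sum using a r_less by (intro sum.cong) (auto simp: lookup_single when_def)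
      ultimately show "Poly_Mapping.lookup (M p) (?r a, a + 1) < Poly_Mapping.lookup (M id) (?r a, a + 1)"
        using a(1) by (simp add: sum.delta)
      fix k assume k: "k < (?r a, a + 1)"
      show "Poly_Mapping.lookup (M p) k = Poly_Mapping.lookup (M id) k"
        unfolding M_def lookup_sum
      proof (intro sum.cong refl)
        fix b assume b: "b \<in> {..<card I}"
        consider "b < a" | "b = a" | "a < b" by linarith
        then show "Poly_Mapping.lookup (Poly_Mapping.single (?r b, p b + 1) (1::nat)) k
          = Poly_Mapping.lookup (Poly_Mapping.single (?r b, id b + 1) 1) k"
        proof cases
          case 1
          then show ?thesis using a(3) by simp
        next
          case 2
          then show ?thesis using k a(2) by (auto simp: lookup_single when_def)
        next
          case 3
          then have "?r a < ?r b" using r_less a(1) b by simp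
          then show ?thesis using k by (auto simp: lookup_single when_def)
        qed
      qed
    qed
  qed
  have exp: "flag_minor I = (\<Sum>p\<in>?P. Poly_Mapping.single (M p) (of_int (sign p)))"
    unfolding M_def by (rule flag_minor_expansion)
  have fin: "finite ?P" by (simp add: finite_permutations)
  have "Poly_Mapping.lookup (flag_minor I) (M id) = (\<Sum>p\<in>?P. if p = id then 1 else 0)"
    unfolding exp lookup_sum
  proof (intro sum.cong refl)
    fix p assume "p \<in> ?P"
    then have "M p = M id \<longleftrightarrow> p = id" using less[of p] by (cases "p = id") auto
    then show "Poly_Mapping.lookup (Poly_Mapping.single (M p) (of_int (sign p))) (M id) = (if p = id then 1 else 0 :: complex)"
      by (simp add: lookup_single when_def sign_id)
  qed
  also have "\<dots> = 1" using fin permutes_id by (simp add: sum.delta)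
  finally show "Poly_Mapping.lookup (flag_minor I) (diagonal_monomial I) = 1" by (simp only: M_id)
  assume "m \<in> Poly_Mapping.keys (flag_minor I)"
  then obtain p where "p \<in> ?P" "m \<in> Poly_Mapping.keys (Poly_Mapping.single (M p) (of_int (sign p) :: complex))"
    using subsetD[OF keys_sum[of "\<lambda>p. Poly_Mapping.single (M p) (of_int (sign p) :: complex)" ?P], of m]
    unfolding exp by auto
  then have "p \<in> ?P" "m = M p" by (auto split: if_splits)
  then show "m \<le> diagonal_monomial I"
    using less[of p] M_id by (cases "p = id") auto
qed

lemma flag_minor_nz: "flag_minor I \<noteq> 0"
  using flag_minor_leading(1)[of I] by auto

lemma tableau_poly_nz: "tableau_poly T \<noteq> 0"
  by (simp add: tableau_poly_def flag_minor_nz)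

lemma lookup_diagonal_monomial_interval:
  "Poly_Mapping.lookup (diagonal_monomial {i..<i + j}) (r, k) = of_bool (1 \<le> k \<and> k \<le> j \<and> r = i + k - 1)"
proof -
  have "Poly_Mapping.lookup (diagonal_monomial {i..<i + j}) (r, k) = (\<Sum>a<j. if a + 1 = k \<and> r = i + a then 1 else 0)"
    unfolding diagonal_monomial_def lookup_sum
    by (auto simp: lookup_single when_def intro!: sum.cong)
  also have "\<dots> = (\<Sum>a<j. if a = k - 1 then of_bool (1 \<le> k \<and> r = i + k - 1) else 0)"
    by (intro sum.cong refl) (cases k; auto)
  also have "\<dots> = of_bool (1 \<le> k \<and> k \<le> j \<and> r = i + k - 1)"
    by (auto simp: sum.delta)
  finally show ?thesis .
qed

section \<open>The initial seed\<close>

text \<open>Values of fractions must lie in an ordered group, so exponents are embedded into integer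
  vectors with the same lexicographic order.\<close>

lift_definition int_exponent :: "('w \<Rightarrow>\<^sub>0 nat) \<Rightarrow> ('w \<Rightarrow>\<^sub>0 int)" is "\<lambda>f k. int (f k)"
  by simp

lemma int_exponent_add: "int_exponent (m + n) = int_exponent m + int_exponent n"
  by transfer auto

lemma inj_int_exponent: "inj int_exponent"
  by (rule injI, transfer) (simp add: fun_eq_iff)

lemma mono_int_exponent: "mono (int_exponent :: ('w::linorder \<Rightarrow>\<^sub>0 nat) \<Rightarrow> _)"
proof (rule monoI)
  fix m n :: "'w \<Rightarrow>\<^sub>0 nat" assume "m \<le> n"
  then show "int_exponent m \<le> int_exponent n"
    unfolding order_le_less poly_mapping_less_iff by (auto simp: int_exponent.rep_eq)
qed

abbreviation lex_val :: "ratfun \<Rightarrow> (nat \<times> nat) \<Rightarrow>\<^sub>0 int" where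
  "lex_val \<equiv> weight_val to_fract UNIV int_exponent"

interpretation lex: weighted_ring "to_fract :: mpoly \<Rightarrow> ratfun" UNIV int_exponent
  by unfold_locales (auto simp: is_subring_UNIV int_exponent_add inj_int_exponent)

lemma ratfun_in_fractions: "(f :: ratfun) \<in> fractions to_fract UNIV"
proof (cases f)
  case (Fract a b)
  then have "f = to_fract a / to_fract b" by (simp add: to_fract_def)
  then show ?thesis using Fract lex.fractionsI[of a b] by simp
qed

text \<open>By \<open>ratfun_in_fractions\<close> the subfield is the whole field of rational
  functions here.\<close>

interpretation nu: seed_valuation "fractions (to_fract :: mpoly \<Rightarrow> ratfun) UNIV" lex_val
  by (intro seed_valuation.intro lex.subfield_valuation_axioms)

lemma lex_val_to_fract:
  assumes "p \<noteq> 0"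
  shows "lex_val (to_fract p) = int_exponent (leading_monomial p)"
proof -
  have "Max (int_exponent ` Poly_Mapping.keys p) = int_exponent (Max (Poly_Mapping.keys p))"
    using assms by (intro mono_Max_commute[symmetric] mono_int_exponent) auto
  then show ?thesis
    using assms by (simp add: lex.weight_val_image weight_def leading_monomial_def)
qed

lemma leading_monomial_flag_minor: "leading_monomial (flag_minor I) = diagonal_monomial I"
  unfolding leading_monomial_def
  by (intro Max_eqI) (auto simp: flag_minor_leading in_keys_iff[of "diagonal_monomial I"])

lemma lookup_val_power:
  fixes val :: "'k::field \<Rightarrow> ('w::linorder \<Rightarrow>\<^sub>0 int)"
  assumes "subfield_valuation R val" "a \<in> R" "a \<noteq> 0"
  shows "Poly_Mapping.lookup (val (a powi n)) q = n * Poly_Mapping.lookup (val a) q"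
proof -
  interpret subfield_valuation R val by fact
  have pow: "Poly_Mapping.lookup (val (b ^ k)) q = int k * Poly_Mapping.lookup (val b) q"
    if "b \<in> R" "b \<noteq> 0" for b k
    using that by (induction k) (auto simp: val_1 val_mult R_closed lookup_add algebra_simps)
  show ?thesis
    using assms(2,3) pow by (auto simp: power_int_def R_closed val_inverse)
qed

lemma lookup_val_lmon:
  fixes val :: "'k::field \<Rightarrow> ('w::linorder \<Rightarrow>\<^sub>0 int)"
  assumes "subfield_valuation R val" "\<And>v. x v \<in> R" "\<And>v. x v \<noteq> 0"
  shows "Poly_Mapping.lookup (val (lmon x m)) q
    = (\<Sum>v\<in>Poly_Mapping.keys m. Poly_Mapping.lookup m v * Poly_Mapping.lookup (val (x v)) q)"
proof -
  interpret subfield_valuation R val by fact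
  have "Poly_Mapping.lookup (val (\<Prod>v\<in>A. x v powi Poly_Mapping.lookup m v)) q
    = (\<Sum>v\<in>A. Poly_Mapping.lookup m v * Poly_Mapping.lookup (val (x v)) q)" if "finite A" for A
    using that
  proof (induction A rule: finite_induct)
    case (insert v A)
    have "(\<Prod>v\<in>A. x v powi Poly_Mapping.lookup m v) \<in> R"
      using assms by (intro R_closed power_int_in)
    then show ?case
      using insert assms by (simp add: val_mult power_int_in lookup_add lookup_val_power[OF assms(1)])
  qed (simp add: val_1)
  then show ?thesis by (simp add: lmon_def)
qed

lemma initial_seed_simps [simp]:
  "vertices (initial_seed n) = initial_vertices n"
  "mutable (initial_seed n) = initial_vertices n - initial_frozen n"
  "cvar (initial_seed n) (i, j) = to_fract (flag_minor {i..<i + j})"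
  by (auto simp: initial_seed_def vertices_def initial_frozen_def)

lemma finite_initial_vertices: "finite (initial_vertices n)"
  by (rule finite_subset[of _ "{..n + 1} \<times> {..n + 1}"]) (auto simp: initial_vertices_def)

text \<open>The matrix is triangular when column \<open>(i, j)\<close> is paired with row
  \<open>(i + 1, j)\<close>: among the neighbours of \<open>(i + 1, j)\<close>, only
  \<open>(i, j)\<close> is lexicographically at most \<open>(i, j)\<close>. So the largest vertex in
  the support of a kernel vector gives a contradiction.\<close>

lemma skew_full_rank_initial: "skew_full_rank (initial_seed n)"
  unfolding skew_full_rank_def
proof (intro conjI allI impI ballI)
  show "finite (vertices (initial_seed n))" by (simp add: finite_initial_vertices)
  show "mult (initial_seed n) a b = - mult (initial_seed n) b a" for a b
    by (simp add: initial_seed_def)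
  fix c :: "nat \<times> nat \<Rightarrow> int" and v
  let ?s = "initial_seed n"
  assume rows: "\<forall>a\<in>vertices ?s. (\<Sum>v\<in>mutable ?s. mult ?s a v * c v) = 0" and v: "v \<in> mutable ?s"
  define S where "S = {v \<in> mutable ?s. c v \<noteq> 0}"
  have finS: "finite S" "finite (mutable ?s)" using finite_initial_vertices by (simp_all add: S_def)
  have "S = {}"
  proof (rule ccontr)
    assume "S \<noteq> {}"
    then have max: "Max S \<in> S" "\<And>v. v \<in> S \<Longrightarrow> v \<le> Max S" using finS by auto
    obtain i j where ij: "Max S = (i, j)" by force
    have v0: "(i, j) \<in> mutable ?s" "c (i, j) \<noteq> 0" using max(1) ij by (auto simp: S_def)
    then have u: "(i + 1, j) \<in> initial_vertices n"
      by (auto simp: initial_vertices_def initial_frozen_def)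
    have "mult ?s (i + 1, j) w * c w = (if w = (i, j) then - c (i, j) else 0)" if w: "w \<in> mutable ?s" for w
    proof (cases "w = (i, j)")
      case True
      then show ?thesis using u v0
        by (auto simp: initial_seed_def initial_edge_def initial_vertices_def)
    next
      case False
      show ?thesis
      proof (cases "c w = 0")
        case nz: False
        then have "w \<le> (i, j)" using w max(2)[of w] ij by (simp add: S_def)
        then have "mult ?s (i + 1, j) w = 0" using False
          by (cases w) (auto simp: initial_seed_def initial_edge_def)
        then show ?thesis using False by simp
      qed (use False in simp)
    qed
    then have "(\<Sum>w\<in>mutable ?s. mult ?s (i + 1, j) w * c w) = (\<Sum>w\<in>mutable ?s. if w = (i, j) then - c (i, j) else 0)"
      by (intro sum.cong) auto
    also have "\<dots> = - c (i, j)" using finS v0 by (simp add: sum.delta)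
    finally show False using rows u v0 by simp
  qed
  then show "c v = 0" using v unfolding S_def by blast
qed

lemma independent_initial: "lex.independent (cvar (initial_seed n)) (initial_vertices n)"
  unfolding lex.independent_def
proof (intro conjI allI ballI impI)
  let ?x = "cvar (initial_seed n)"
  show nz: "?x v \<noteq> 0" for v by (cases v) (simp add: flag_minor_nz)
  show "?x v \<in> fractions to_fract UNIV" for v by (rule ratfun_in_fractions)
  fix m assume m: "Poly_Mapping.keys m \<subseteq> initial_vertices n" "lex_val (lmon ?x m) = 0"
  show "m = 0"
  proof (rule ccontr)
    assume "m \<noteq> 0"
    then have max: "Max (Poly_Mapping.keys m) \<in> Poly_Mapping.keys m"
      "\<And>v. v \<in> Poly_Mapping.keys m \<Longrightarrow> v \<le> Max (Poly_Mapping.keys m)" by auto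
    obtain i j where ij: "Max (Poly_Mapping.keys m) = (i, j)" by force
    have ij': "(i, j) \<in> Poly_Mapping.keys m" "1 \<le> j" using max(1) ij m(1) by (auto simp: initial_vertices_def)
    \<comment> \<open>The position \<open>(i + j - 1, j)\<close> is the last diagonal entry of the
      minor at \<open>(i, j)\<close>. It lies on the diagonal of the minor at
      \<open>(i', j')\<close> exactly if \<open>i' = i\<close> and \<open>j' \<ge> j\<close>, so
      maximality of \<open>(i, j)\<close> leaves a single contribution.\<close>
    have "Poly_Mapping.lookup (lex_val (?x v)) (i + j - 1, j) = (if v = (i, j) then 1 else 0)"
      if v: "v \<in> Poly_Mapping.keys m" for v
    proof -
      obtain i' j' where v': "v = (i', j')" by force
      have "v \<le> (i, j)" using max(2)[OF v] ij by simp
      then show ?thesis using ij'(2) v'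
        by (auto simp: lex_val_to_fract flag_minor_nz leading_monomial_flag_minor int_exponent.rep_eq
            lookup_diagonal_monomial_interval)
    qed
    then have "Poly_Mapping.lookup (lex_val (lmon ?x m)) (i + j - 1, j)
        = (\<Sum>v\<in>Poly_Mapping.keys m. if v = (i, j) then Poly_Mapping.lookup m (i, j) else 0)"
      unfolding lookup_val_lmon[where x = ?x, OF lex.subfield_valuation_axioms ratfun_in_fractions nz]
      by (intro sum.cong refl) simp
    then show False using m(2) ij'(1) by (simp add: sum.delta in_keys_iff)
  qed
qed

lemma admissible_initial: "nu.admissible (initial_seed n)"
  by (simp add: nu.admissible_def skew_full_rank_initial independent_initial)

lemma seeds_fold_mutate:
  assumes "s \<in> seeds n"
  obtains ks where "set ks \<subseteq> mutable (initial_seed n)" "s = fold mutate ks (initial_seed n)"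
proof -
  have "\<exists>ks. set ks \<subseteq> mutable (initial_seed n) \<and> s = fold mutate ks (initial_seed n)"
    using assms
  proof induction
    case initial
    show ?case by (intro exI[of _ "[]"]) simp
  next
    case (mutation s v)
    then obtain ks where "set ks \<subseteq> mutable (initial_seed n)" "s = fold mutate ks (initial_seed n)" by blast
    then show ?case
      using mutation.hyps(2) fold_mutate_simps(1)[of ks "initial_seed n"]
      by (intro exI[of _ "ks @ [v]"]) (simp del: initial_seed_simps)
  qed
  then show thesis using that by blast
qed

lemma leading_monomial_add_smaller:
  assumes "D \<noteq> 0" "smaller_than E D"
  shows "Poly_Mapping.lookup (D + E) (leading_monomial D) = Poly_Mapping.lookup D (leading_monomial D)"
    "Poly_Mapping.lookup D (leading_monomial D) \<noteq> 0"
    "leading_monomial (D + E) = leading_monomial D" "D + E \<noteq> 0"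
proof -
  let ?m = "leading_monomial D"
  have E: "k < ?m" if "k \<in> Poly_Mapping.keys E" for k
  proof -
    have "k \<le> leading_monomial E" using that by (simp add: leading_monomial_def)
    also have "\<dots> < ?m" using assms(2) that by (auto simp: smaller_than_def)
    finally show ?thesis .
  qed
  then have E0: "Poly_Mapping.lookup E ?m = 0" by (metis in_keys_iff order_less_irrefl)
  then show eq: "Poly_Mapping.lookup (D + E) ?m = Poly_Mapping.lookup D ?m" by (simp add: lookup_add)
  have "?m \<in> Poly_Mapping.keys D"
    unfolding leading_monomial_def using assms(1) by (intro Max_in) auto
  then show nz: "Poly_Mapping.lookup D ?m \<noteq> 0" by (simp add: in_keys_iff)
  then have "?m \<in> Poly_Mapping.keys (D + E)" using eq by (simp add: in_keys_iff)
  moreover have "k \<le> ?m" if k: "k \<in> Poly_Mapping.keys (D + E)" for k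
  proof -
    have "k \<in> Poly_Mapping.keys D \<or> k \<in> Poly_Mapping.keys E" using k keys_add[of D E] by auto
    moreover have "k \<le> ?m" if "k \<in> Poly_Mapping.keys D"
      using that by (simp add: leading_monomial_def)
    ultimately show ?thesis using E[of k] by auto
  qed
  ultimately show "leading_monomial (D + E) = ?m"
    unfolding leading_monomial_def[of "D + E"] by (intro Max_eqI) auto
  show "D + E \<noteq> 0" using eq nz by (metis lookup_zero)
qed

lemma lookup_of_int_mult: "Poly_Mapping.lookup (of_int c * p) m = of_int c * Poly_Mapping.lookup (p :: mpoly) m"
proof -
  have "of_int c * p = Poly_Mapping.map ((*) (of_int c)) p"
    by (simp add: mult_map_scale_conv_mult)
  then show ?thesis by (simp add: Poly_Mapping.map.rep_eq when_def)
qed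

theorem theoremM2:
  fixes n :: nat and P Q :: ratfun and T :: "nat list list" and P' Q' :: mpoly
  assumes "n \<ge> 1"
    and "P \<in> cluster_variables n" and "Q \<in> cluster_variables n"
    and "ssyt n T"
    and "P' \<in> invariant_ring n" and "Q' \<in> invariant_ring n"
    and "smaller_than P' (tableau_poly T)" and "smaller_than Q' (tableau_poly T)"
    and "P = to_fract (tableau_poly T + P')" and "Q = to_fract (tableau_poly T + Q')"
  shows "P = Q"
proof -
  let ?s = "initial_seed n" and ?m = "leading_monomial (tableau_poly T)"
  note lead = leading_monomial_add_smaller[OF tableau_poly_nz]
  obtain t v where t: "t \<in> seeds n" "v \<in> vertices t" "P = cvar t v"
    using assms(2) by (auto simp: cluster_variables_def)
  obtain s w where s: "s \<in> seeds n" "w \<in> vertices s" "Q = cvar s w"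
    using assms(3) by (auto simp: cluster_variables_def)
  obtain ks where ks: "set ks \<subseteq> mutable ?s" "t = fold mutate ks ?s" using seeds_fold_mutate[OF t(1)] .
  obtain ls where ls: "set ls \<subseteq> mutable ?s" "s = fold mutate ls ?s" using seeds_fold_mutate[OF s(1)] .
  \<comment> \<open>Going back to the initial seed and on to \<open>s\<close> gives a path of
    mutations from \<open>t\<close> to \<open>s\<close>.\<close>
  have "fold mutate (rev ks) t = ?s"
    unfolding ks(2) using nu.fold_mutate_rev[OF admissible_initial ks(1)] .
  then have path: "s = fold mutate (rev ks @ ls) t" by (simp add: ls(2))
  have adm: "nu.admissible t"
    unfolding ks(2) using nu.admissible_fold[OF admissible_initial ks(1)] .
  have "lex_val Q = lex_val P"
    unfolding assms(9,10) lex_val_to_fract[OF lead(4)[OF assms(7)]] lex_val_to_fract[OF lead(4)[OF assms(8)]]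
    by (simp only: lead(3)[OF assms(7)] lead(3)[OF assms(8)])
  moreover have "set (rev ks @ ls) \<subseteq> mutable t" "v \<in> vertices t" "w \<in> vertices t"
    using ks ls t(2) s(2) by (auto simp: fold_mutate_simps)
  ultimately obtain c where "Q = of_int c * P"
    using nu.cluster_variable_determined_by_val[OF adm _ path] t(3) s(3) by metis
  then have "to_fract (tableau_poly T + Q') = to_fract (of_int c * (tableau_poly T + P'))"
    unfolding assms(9,10) by (simp only: to_fract_mult lex.psi_of_int)
  then have eq: "tableau_poly T + Q' = of_int c * (tableau_poly T + P')" by (simp only: to_fract_eq_iff)
  have "Poly_Mapping.lookup (tableau_poly T) ?m = of_int c * Poly_Mapping.lookup (tableau_poly T) ?m"
    using arg_cong[OF eq, of "\<lambda>p. Poly_Mapping.lookup p ?m"] lead(1)[OF assms(7)] lead(1)[OF assms(8)]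
    by (simp only: lookup_of_int_mult)
  then have "(of_int c :: complex) = 1" using lead(2)[OF assms(7)] by simp
  then have "c = 1" by simp
  then show "P = Q" using \<open>Q = of_int c * P\<close> by simp
qed

end
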